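(* Assume that $\ell(\cdot,b):\mathbb{R}^s\to\mathbb{R}$ is $L_\ell$-smooth and convex and that each $r_i:\mathbb{R}^{d_i}\to\mathbb{R}$ ($i=1,\dots,n$) is $L_r$-smooth and convex. Let the sequence be generated by the algorithm described in the context, from any starting point $(x^0,z^0,y^0)\in\mathbb{R}^{d+2sn}$, with stepsize $$\gamma=\frac12\min\left\{1;\ \frac1{\sqrt{\max_i\{\lambda_{\max}(A_i^TA_i)\}}};\ \frac1{L_r};\ \frac1{nL_\ell}\right\}.$$ Then there is an absolute constant $C>0$ such that for every $K\ge1$ $$\mathrm{gap}_1(\bar x^K,\bar z^K,\bar y^K)\le C\,\frac{\left(1+\sqrt{\max_{i=1,\dots,n}\{\lambda_{\max}(A_i^TA_i)\}}+nL_\ell+L_r\right)\tilde D^2}{K},$$ where $\bar x^K=\frac1K\sum_{k=0}^{K-1}x^{k+1/2}$, $\bar z_i^K=\frac1K\sum_{k=0}^{K-1}z_i^{k+1/2}$, $\bar y_i^K=\frac1K\sum_{k=0}^{K-1}y_i^{k+1/2}$ for $i=1,\dots,n$, and $\tilde D^2=\max_{x\in\mathcal X,z\in\tilde{\mathcal Z},y\in\tilde{\mathcal Y}}\left[\|x^0-x\|^2+\|z^0-z\|^2+\|y^0-y\|^2\right]$.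
   Context: Setting: $n,s,d_1,\dots,d_n$ are positive integers, $d=\sum_i d_i$, $A_i\in\mathbb{R}^{s\times d_i}$, $b\in\mathbb{R}^s$ is fixed, $x=(x_1,\dots,x_n)\in\mathbb{R}^d$ with $x_i\in\mathbb{R}^{d_i}$, and $z=(z_1,\dots,z_n)$, $y=(y_1,\dots,y_n)\in\mathbb{R}^{sn}$ with $z_i,y_i\in\mathbb{R}^s$. $\ell:\mathbb{R}^s\times\mathbb{R}^s\to\mathbb{R}$, and $\nabla\ell(\cdot,b)$ is the gradient in the first argument. The saddle point problem is $\min_{(x,z)\in\mathbb{R}^{d+sn}}\max_{y\in\mathbb{R}^{sn}}\tilde L(x,z,y)$ with $$\tilde L(x,z,y)=\ell\Big(\sum_{i=1}^nz_i,b\Big)+\sum_{i=1}^nr_i(x_i)+\sum_{i=1}^ny_i^T(A_ix_i-z_i).$$ $\mathcal X\subset\mathbb{R}^d$, $\tilde{\mathcal Z}\subset\mathbb{R}^{sn}$, $\tilde{\mathcal Y}\subset\mathbb{R}^{sn}$ are nonempty compact sets used only to define the criterion $$\mathrm{gap}_1(x,z,y)=\max_{\tilde y\in\tilde{\mathcal Y}}\tilde L(x,z,\tilde y)-\min_{\tilde x\in\mathcal X,\tilde z\in\tilde{\mathcal Z}}\tilde L(\tilde x,\tilde z,y).$$ A function $f$ is $L$-smooth ($L>0$) if it is differentiable and $\|\nabla f(u)-\nabla f(v)\|\le L\|u-v\|$ for all $u,v$. Norms are Euclidean; $\lambda_{\max}$ is the largest eigenvalue; $1/0=+\infty$. Algorithm: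 for $k=0,\dots,K-1$ and all $i=1,\dots,n$, $x_i^{k+1/2}=x_i^k-\gamma(A_i^Ty_i^k+\nabla r_i(x_i^k))$; $z_i^{k+1/2}=z_i^k-\gamma(\nabla\ell(\sum_jz_j^k,b)-y_i^k)$; $y_i^{k+1/2}=y_i^k+\gamma(A_ix_i^k-z_i^k)$; $x_i^{k+1}=x_i^k-\gamma(A_i^Ty_i^{k+1/2}+\nabla r_i(x_i^{k+1/2}))$; $z_i^{k+1}=z_i^k-\gamma(\nabla\ell(\sum_jz_j^{k+1/2},b)-y_i^{k+1/2})$; $y_i^{k+1}=y_i^k+\gamma(A_ix_i^{k+1/2}-z_i^{k+1/2})$. *)

theory Defs
  imports
    "HOL-Analysis.Abstract_Metric_Spaces"
    "HOL-Analysis.L2_Norm"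
    "HOL-Library.Extended_Real"
    "Jordan_Normal_Form.Spectral_Radius"
begin

text \<open>The constant of the bound is absolute, that is, independent of all dimensions, so the
  dimensions have to be quantified inside the statement and cannot be types. Elements of
  \<open>\<real>\<^sup>m\<close> are therefore rendered by \<open>carrier_vec m\<close>, and block vectors
  \<open>(u\<^sub>1, \<dots>, u\<^sub>n)\<close> with \<open>u\<^sub>i \<in> \<real>\<^bsup>m i\<^esup>\<close> by functions on the index set \<open>{1..n}\<close>.\<close>

definition enorm :: "real Matrix.vec \<Rightarrow> real" where
  "enorm v = L2_set (vec_index v) {..<dim_vec v}"

definition block_space :: "nat \<Rightarrow> (nat \<Rightarrow> nat) \<Rightarrow> (nat \<Rightarrow> real Matrix.vec) set" where
  "block_space n m = (\<Pi>\<^sub>E i\<in>{1..n}. carrier_vec (m i))"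

text \<open>Euclidean distance on \<open>\<real>\<^bsup>m 1 + \<dots> + m n\<^esup>\<close>. It is written through the coordinates
  because \<open>Metric_space\<close> wants symmetry outside the carrier as well, which fails for
  differences of vectors of distinct dimensions.\<close>

definition block_dist ::
    "nat \<Rightarrow> (nat \<Rightarrow> nat) \<Rightarrow> (nat \<Rightarrow> real Matrix.vec) \<Rightarrow> (nat \<Rightarrow> real Matrix.vec) \<Rightarrow> real" where
  "block_dist n m u v = L2_set (\<lambda>(i, j). vec_index (u i) j - vec_index (v i) j) (SIGMA i:{1..n}. {..<m i})"

lemma Metric_space_block: "Metric_space (block_space n m) (block_dist n m)"
proof
  fix u v
  show "0 \<le> block_dist n m u v" by (simp add: block_dist_def)
next
  fix u v
  show "block_dist n m u v = block_dist n m v u"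
    by (simp add: block_dist_def L2_set_def case_prod_beta power2_commute)
next
  fix u v
  assume uv: "u \<in> block_space n m" "v \<in> block_space n m"
  have "block_dist n m u v = 0 \<longleftrightarrow> (\<forall>i\<in>{1..n}. u i = v i)"
  proof -
    have dim: "dim_vec (u i) = m i" "dim_vec (v i) = m i" if "i \<in> {1..n}" for i
      using uv that by (auto simp: block_space_def PiE_iff)
    have "block_dist n m u v = 0 \<longleftrightarrow> (\<forall>i\<in>{1..n}. \<forall>j<m i. vec_index (u i) j = vec_index (v i) j)"
      unfolding block_dist_def by (subst L2_set_eq_0_iff) auto
    also have "\<dots> \<longleftrightarrow> (\<forall>i\<in>{1..n}. u i = v i)"
      using dim by (intro ball_cong) (auto simp: Matrix.vec_eq_iff)
    finally show ?thesis .
  qed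
  also have "\<dots> \<longleftrightarrow> u = v"
    using uv PiE_ext[of u "{1..n}" _ v] unfolding block_space_def by blast
  finally show "block_dist n m u v = 0 \<longleftrightarrow> u = v" .
next
  fix u v w
  have "block_dist n m u w = L2_set (\<lambda>p. (case p of (i, j) \<Rightarrow> vec_index (u i) j - vec_index (v i) j)
      + (case p of (i, j) \<Rightarrow> vec_index (v i) j - vec_index (w i) j)) (SIGMA i:{1..n}. {..<m i})"
    unfolding block_dist_def by (intro L2_set_cong) auto
  also have "\<dots> \<le> block_dist n m u v + block_dist n m v w"
    unfolding block_dist_def by (rule L2_set_triangle_ineq)
  finally show "block_dist n m u w \<le> block_dist n m u v + block_dist n m v w" .
qed

definition block_compact :: "nat \<Rightarrow> (nat \<Rightarrow> nat) \<Rightarrow> (nat \<Rightarrow> real Matrix.vec) set \<Rightarrow> bool" where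
  "block_compact n m S \<longleftrightarrow> compactin (Metric_space.mtopology (block_space n m) (block_dist n m)) S"

definition has_gradient ::
    "nat \<Rightarrow> (real Matrix.vec \<Rightarrow> real) \<Rightarrow> real Matrix.vec \<Rightarrow> real Matrix.vec \<Rightarrow> bool" where
  "has_gradient m f g u \<longleftrightarrow> g \<in> carrier_vec m \<and>
     (\<forall>\<epsilon>>0. \<exists>\<delta>>0. \<forall>v\<in>carrier_vec m. enorm (v - u) < \<delta> \<longrightarrow>
        \<bar>f v - f u - scalar_prod g (v - u)\<bar> \<le> \<epsilon> * enorm (v - u))"

lemma has_gradient_unique:
  assumes u: "u \<in> carrier_vec m" and 1: "has_gradient m f g u" and 2: "has_gradient m f h u"
  shows "g = h"
proof (rule ccontr)
  assume neq: "g \<noteq> h"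
  have c: "g \<in> carrier_vec m" "h \<in> carrier_vec m"
    using 1 2 by (auto simp: has_gradient_def)
  define w where "w = g - h"
  have w: "w \<in> carrier_vec m" using c by (simp add: w_def)
  have sq: "scalar_prod w w = (enorm w)\<^sup>2"
    by (simp add: scalar_prod_def enorm_def L2_set_def sum_nonneg power2_eq_square atLeast0LessThan)
  have "enorm w \<noteq> 0"
  proof
    assume "enorm w = 0"
    then have "\<forall>j<m. vec_index w j = 0"
      using w by (auto simp: enorm_def L2_set_eq_0_iff)
    then have "g = h" using c by (auto simp: w_def Matrix.vec_eq_iff)
    with neq show False by simp
  qed
  then have pos: "enorm w > 0" by (simp add: enorm_def less_le)
  define e where "e = enorm w / 4"
  have "e > 0" using pos by (simp add: e_def)
  obtain d1 where d1: "d1 > 0" "\<And>v. v \<in> carrier_vec m \<Longrightarrow> enorm (v - u) < d1 \<Longrightarrow>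
      \<bar>f v - f u - scalar_prod g (v - u)\<bar> \<le> e * enorm (v - u)"
    using 1 \<open>e > 0\<close> unfolding has_gradient_def by meson
  obtain d2 where d2: "d2 > 0" "\<And>v. v \<in> carrier_vec m \<Longrightarrow> enorm (v - u) < d2 \<Longrightarrow>
      \<bar>f v - f u - scalar_prod h (v - u)\<bar> \<le> e * enorm (v - u)"
    using 2 \<open>e > 0\<close> unfolding has_gradient_def by meson
  define t where "t = min d1 d2 / (2 * enorm w)"
  have t: "t > 0" using d1(1) d2(1) pos by (simp add: t_def)
  define v where "v = u + t \<cdot>\<^sub>v w"
  have v: "v \<in> carrier_vec m" using u w by (simp add: v_def)
  have vu: "v - u = t \<cdot>\<^sub>v w" using u w by (auto simp: v_def)
  have n: "enorm (v - u) = t * enorm w"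
    unfolding vu using t by (auto simp: enorm_def L2_set_right_distrib intro!: L2_set_cong)
  have small: "t * enorm w < d1" "t * enorm w < d2"
    using pos d1(1) d2(1) by (auto simp: t_def)
  have "scalar_prod g (v - u) - scalar_prod h (v - u) = scalar_prod w (v - u)"
    unfolding w_def using c u v by (simp add: minus_scalar_prod_distrib[of _ m])
  also have "\<dots> = t * (enorm w)\<^sup>2"
    unfolding vu using w by (simp add: sq)
  finally have "t * (enorm w)\<^sup>2 \<le> 2 * (e * (t * enorm w))"
    using d1(2)[OF v] d2(2)[OF v] small n by (smt (verit))
  also have "\<dots> = t * (enorm w)\<^sup>2 / 2"
    by (simp add: e_def power2_eq_square)
  finally show False using t pos by simp
qed

definition gradient :: "nat \<Rightarrow> (real Matrix.vec \<Rightarrow> real) \<Rightarrow> real Matrix.vec \<Rightarrow> real Matrix.vec" where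
  "gradient m f u = (THE g. has_gradient m f g u)"

definition L_smooth :: "nat \<Rightarrow> real \<Rightarrow> (real Matrix.vec \<Rightarrow> real) \<Rightarrow> bool" where
  "L_smooth m L f \<longleftrightarrow> 0 < L \<and> (\<forall>u\<in>carrier_vec m. \<exists>g. has_gradient m f g u) \<and>
     (\<forall>u\<in>carrier_vec m. \<forall>v\<in>carrier_vec m.
        enorm (gradient m f u - gradient m f v) \<le> L * enorm (u - v))"

definition convex_fun :: "nat \<Rightarrow> (real Matrix.vec \<Rightarrow> real) \<Rightarrow> bool" where
  "convex_fun m f \<longleftrightarrow> (\<forall>u\<in>carrier_vec m. \<forall>v\<in>carrier_vec m. \<forall>t\<in>{0..1}.
     f ((1 - t) \<cdot>\<^sub>v u + t \<cdot>\<^sub>v v) \<le> (1 - t) * f u + t * f v)"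

text \<open>Maximum and minimum as attained values; \<open>Max\<close> and \<open>Min\<close> are meant for finite sets only.\<close>

definition max_on :: "'a set \<Rightarrow> ('a \<Rightarrow> real) \<Rightarrow> real" where
  "max_on S f = (GREATEST v. v \<in> f ` S)"

definition min_on :: "'a set \<Rightarrow> ('a \<Rightarrow> real) \<Rightarrow> real" where
  "min_on S f = (LEAST v. v \<in> f ` S)"

definition max_lambda :: "nat \<Rightarrow> (nat \<Rightarrow> real Matrix.mat) \<Rightarrow> real" where
  "max_lambda n A = (MAX i\<in>{1..n}. Max (spectrum (transpose_mat (A i) * A i)))"

definition lagrangian ::
    "nat \<Rightarrow> nat \<Rightarrow> (nat \<Rightarrow> real Matrix.mat) \<Rightarrow> (real Matrix.vec \<Rightarrow> real Matrix.vec \<Rightarrow> real) \<Rightarrow>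
     real Matrix.vec \<Rightarrow> (nat \<Rightarrow> real Matrix.vec \<Rightarrow> real) \<Rightarrow>
     (nat \<Rightarrow> real Matrix.vec) \<Rightarrow> (nat \<Rightarrow> real Matrix.vec) \<Rightarrow> (nat \<Rightarrow> real Matrix.vec) \<Rightarrow> real" where
  "lagrangian n s A l b r x z y =
     l (finsum_vec TYPE(real) s z {1..n}) b + (\<Sum>i=1..n. r i (x i))
     + (\<Sum>i=1..n. scalar_prod (y i) (A i *\<^sub>v x i - z i))"

definition gap1 ::
    "nat \<Rightarrow> nat \<Rightarrow> (nat \<Rightarrow> real Matrix.mat) \<Rightarrow> (real Matrix.vec \<Rightarrow> real Matrix.vec \<Rightarrow> real) \<Rightarrow>
     real Matrix.vec \<Rightarrow> (nat \<Rightarrow> real Matrix.vec \<Rightarrow> real) \<Rightarrow>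
     (nat \<Rightarrow> real Matrix.vec) set \<Rightarrow> (nat \<Rightarrow> real Matrix.vec) set \<Rightarrow> (nat \<Rightarrow> real Matrix.vec) set \<Rightarrow>
     (nat \<Rightarrow> real Matrix.vec) \<Rightarrow> (nat \<Rightarrow> real Matrix.vec) \<Rightarrow> (nat \<Rightarrow> real Matrix.vec) \<Rightarrow> real" where
  "gap1 n s A l b r X Z Y x z y =
     max_on Y (\<lambda>y'. lagrangian n s A l b r x z y')
     - min_on (X \<times> Z) (\<lambda>(x', z'). lagrangian n s A l b r x' z' y)"

text \<open>\<open>xh k\<close>, \<open>zh k\<close>, \<open>yh k\<close> are the iterates with index \<open>k + 1/2\<close>.\<close>

definition extragradient_run ::
    "nat \<Rightarrow> nat \<Rightarrow> (nat \<Rightarrow> nat) \<Rightarrow> (nat \<Rightarrow> real Matrix.mat) \<Rightarrow>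
     (real Matrix.vec \<Rightarrow> real Matrix.vec \<Rightarrow> real) \<Rightarrow> real Matrix.vec \<Rightarrow>
     (nat \<Rightarrow> real Matrix.vec \<Rightarrow> real) \<Rightarrow> real \<Rightarrow> nat \<Rightarrow>
     (nat \<Rightarrow> nat \<Rightarrow> real Matrix.vec) \<Rightarrow> (nat \<Rightarrow> nat \<Rightarrow> real Matrix.vec) \<Rightarrow> (nat \<Rightarrow> nat \<Rightarrow> real Matrix.vec) \<Rightarrow>
     (nat \<Rightarrow> nat \<Rightarrow> real Matrix.vec) \<Rightarrow> (nat \<Rightarrow> nat \<Rightarrow> real Matrix.vec) \<Rightarrow> (nat \<Rightarrow> nat \<Rightarrow> real Matrix.vec) \<Rightarrow>
     bool" where
  "extragradient_run n s d A l b r \<gamma> K x z y xh zh yh \<longleftrightarrow>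
     (\<forall>k<K. \<forall>i\<in>{1..n}.
        xh k i = x k i - \<gamma> \<cdot>\<^sub>v (transpose_mat (A i) *\<^sub>v y k i + gradient (d i) (r i) (x k i)) \<and>
        zh k i = z k i - \<gamma> \<cdot>\<^sub>v (gradient s (\<lambda>u. l u b) (finsum_vec TYPE(real) s (z k) {1..n}) - y k i) \<and>
        yh k i = y k i + \<gamma> \<cdot>\<^sub>v (A i *\<^sub>v x k i - z k i) \<and>
        x (Suc k) i = x k i - \<gamma> \<cdot>\<^sub>v (transpose_mat (A i) *\<^sub>v yh k i + gradient (d i) (r i) (xh k i)) \<and>
        z (Suc k) i = z k i - \<gamma> \<cdot>\<^sub>v (gradient s (\<lambda>u. l u b) (finsum_vec TYPE(real) s (zh k) {1..n}) - yh k i) \<and>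
        y (Suc k) i = y k i + \<gamma> \<cdot>\<^sub>v (A i *\<^sub>v xh k i - zh k i))"

definition block_average :: "nat \<Rightarrow> (nat \<Rightarrow> nat) \<Rightarrow> nat \<Rightarrow> (nat \<Rightarrow> nat \<Rightarrow> real Matrix.vec) \<Rightarrow> nat \<Rightarrow> real Matrix.vec" where
  "block_average n m K w = (\<lambda>i\<in>{1..n}. (1 / real K) \<cdot>\<^sub>v finsum_vec TYPE(real) (m i) (\<lambda>k. w k i) {..<K})"

text \<open>Extended reals give the convention \<open>1 / 0 = \<infinity>\<close>, which matters when all \<open>A i\<close> vanish.\<close>

definition stepsize :: "nat \<Rightarrow> (nat \<Rightarrow> real Matrix.mat) \<Rightarrow> real \<Rightarrow> real \<Rightarrow> ereal" where
  "stepsize n A Lr Ll = ereal (1 / 2) *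
     Min {1, 1 / ereal (sqrt (max_lambda n A)), 1 / ereal Lr, 1 / ereal (real n * Ll)}"

lemma one_divide_ereal_zero: "1 / ereal 0 = \<infinity>"
  by (simp add: divide_ereal_def)

definition D_squared ::
    "nat \<Rightarrow> nat \<Rightarrow> (nat \<Rightarrow> nat) \<Rightarrow>
     (nat \<Rightarrow> real Matrix.vec) set \<Rightarrow> (nat \<Rightarrow> real Matrix.vec) set \<Rightarrow> (nat \<Rightarrow> real Matrix.vec) set \<Rightarrow>
     (nat \<Rightarrow> real Matrix.vec) \<Rightarrow> (nat \<Rightarrow> real Matrix.vec) \<Rightarrow> (nat \<Rightarrow> real Matrix.vec) \<Rightarrow> real" where
  "D_squared n s d X Z Y x0 z0 y0 = max_on (X \<times> Z \<times> Y)
     (\<lambda>(x, z, y). (block_dist n d x0 x)\<^sup>2 + (block_dist n (\<lambda>_. s) z0 z)\<^sup>2 + (block_dist n (\<lambda>_. s) y0 y)\<^sup>2)"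

end

theory Submission
  imports Defs "HOL-Analysis.Convex" "HOL-Analysis.Function_Topology"
begin

text \<open>Extragradient analysis with the constant \<open>C = 1\<close>. For the operator
  \<open>F = (\<nabla>\<^sub>x L, \<nabla>\<^sub>z L, - \<nabla>\<^sub>y L)\<close> and a reference point \<open>u = (x', z', y')\<close>, one step from \<open>w\<close> through
  \<open>w\<^sub>h\<close> to \<open>w\<^sub>+\<close> satisfies
  \<open>\<bar>w\<^sub>+ - u\<bar>\<^sup>2 = \<bar>w - u\<bar>\<^sup>2 - 2 \<gamma> \<langle>F w\<^sub>h, w\<^sub>h - u\<rangle> + \<gamma>\<^sup>2 \<bar>F w\<^sub>h - F w\<bar>\<^sup>2 - \<bar>w\<^sub>h - w\<bar>\<^sup>2\<close>,
  and the last two terms have a nonpositive sum because \<open>\<gamma> F\<close> is nonexpansive. By convexity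
  \<open>\<langle>F w\<^sub>h, w\<^sub>h - u\<rangle>\<close> dominates \<open>L x\<^sub>h z\<^sub>h y' - L x' z' y\<^sub>h\<close>, so telescoping and Jensen's inequality bound
  the gap of the averages by \<open>\<bar>w\<^sub>0 - u\<bar>\<^sup>2 / (2 \<gamma> K)\<close>, and
  \<open>1 / (2 \<gamma>) = max {1, sqrt \<lambda>, Lr, n Ll}\<close> is at most the sum of the four quantities.\<close>

text \<open>Frees \<open>\<bullet>\<close> and \<open>$\<close>, which otherwise also denote the
  type-class inner product and the components of typed vectors, for vectors in
  \<open>carrier_vec m\<close>.\<close>

unbundle no inner_syntax and no vec_syntax

section \<open>Euclidean vectors and gradients\<close>

lemma enorm_nonneg [simp]: "0 \<le> enorm v"
  by (simp add: enorm_def)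

lemma enorm_zero [simp]: "enorm (0\<^sub>v m) = 0"
  by (simp add: enorm_def L2_set_eq_0_iff)

lemma enorm_power2:
  assumes "v \<in> carrier_vec m"
  shows "(enorm v)\<^sup>2 = (\<Sum>j<m. (v $ j)\<^sup>2)"
  using assms by (simp add: enorm_def L2_set_def sum_nonneg)

lemma scalar_prod_sum_lessThan:
  assumes "w \<in> carrier_vec m"
  shows "v \<bullet> w = (\<Sum>j<m. v $ j * w $ j)"
  using assms by (simp add: scalar_prod_def atLeast0LessThan)

lemma index_minus_carrier_vec:
  fixes v :: "real Matrix.vec"
  assumes "v \<in> carrier_vec m" "j < m"
  shows "(u - v) $ j = u $ j - v $ j"
  using assms by simp

lemma scalar_prod_self: "v \<bullet> v = (enorm v)\<^sup>2"
  using enorm_power2[of v "dim_vec v"] scalar_prod_sum_lessThan[of v "dim_vec v" v]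
  by (simp add: power2_eq_square)

lemma enorm_smult: "enorm (c \<cdot>\<^sub>v v) = \<bar>c\<bar> * enorm v"
  by (simp add: enorm_def L2_set_def power_mult_distrib flip: sum_distrib_left)
    (simp add: real_sqrt_mult)

lemma enorm_power2_add_le:
  assumes "u \<in> carrier_vec m" "v \<in> carrier_vec m"
  shows "(enorm (u + v))\<^sup>2 \<le> 2 * (enorm u)\<^sup>2 + 2 * (enorm v)\<^sup>2"
proof -
  have "(a + b)\<^sup>2 \<le> 2 * a\<^sup>2 + 2 * b\<^sup>2" for a b :: real
    using zero_le_power2[of "a - b"] by (simp add: power2_eq_square algebra_simps)
  then have "(\<Sum>j<m. (u $ j + v $ j)\<^sup>2) \<le> (\<Sum>j<m. 2 * (u $ j)\<^sup>2 + 2 * (v $ j)\<^sup>2)"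
    by (intro sum_mono) auto
  then show ?thesis
    using assms by (simp add: enorm_power2[of _ m] sum.distrib sum_distrib_left)
qed

lemma enorm_power2_diff_le:
  assumes "u \<in> carrier_vec m" "v \<in> carrier_vec m"
  shows "(enorm (u - v))\<^sup>2 \<le> 2 * (enorm u)\<^sup>2 + 2 * (enorm v)\<^sup>2"
proof -
  have "u - v = u + (- 1) \<cdot>\<^sub>v v" using assms by auto
  then show ?thesis using enorm_power2_add_le[of u m "(- 1) \<cdot>\<^sub>v v"] assms by (simp add: enorm_smult)
qed

lemma abs_scalar_prod_le:
  assumes "u \<in> carrier_vec m" "v \<in> carrier_vec m"
  shows "\<bar>u \<bullet> v\<bar> \<le> enorm u * enorm v"
proof -
  have "\<bar>u \<bullet> v\<bar> \<le> (\<Sum>j<m. \<bar>u $ j\<bar> * \<bar>v $ j\<bar>)"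
    unfolding scalar_prod_sum_lessThan[OF assms(2)] by (rule order_trans[OF sum_abs]) (simp add: abs_mult)
  also have "\<dots> \<le> enorm u * enorm v"
    using assms L2_set_mult_ineq[of "\<lambda>j. u $ j" "\<lambda>j. v $ j" "{..<m}"] by (simp add: enorm_def)
  finally show ?thesis .
qed

lemma finsum_vec_carrier:
  assumes "\<And>i. i \<in> I \<Longrightarrow> f i \<in> carrier_vec m"
  shows "finsum_vec TYPE(real) m f I \<in> carrier_vec m"
  using assms by (intro finsum_vec_closed) auto

lemma index_finsum_vec_real:
  assumes "finite I" "\<And>i. i \<in> I \<Longrightarrow> f i \<in> carrier_vec m" "j < m"
  shows "finsum_vec TYPE(real) m f I $ j = (\<Sum>i\<in>I. f i $ j)"
  using assms by (intro index_finsum_vec) auto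

lemma scalar_prod_finsum_diff:
  assumes "finite I" "g \<in> carrier_vec m"
    "\<And>i. i \<in> I \<Longrightarrow> u i \<in> carrier_vec m" "\<And>i. i \<in> I \<Longrightarrow> v i \<in> carrier_vec m"
  shows "g \<bullet> (finsum_vec TYPE(real) m u I - finsum_vec TYPE(real) m v I) = (\<Sum>i\<in>I. g \<bullet> (u i - v i))"
proof -
  have c: "finsum_vec TYPE(real) m u I \<in> carrier_vec m" "finsum_vec TYPE(real) m v I \<in> carrier_vec m"
    using assms by (auto intro!: finsum_vec_carrier)
  have "g \<bullet> (finsum_vec TYPE(real) m u I - finsum_vec TYPE(real) m v I)
      = (\<Sum>j<m. g $ j * ((\<Sum>i\<in>I. u i $ j) - (\<Sum>i\<in>I. v i $ j)))"
    using assms c by (subst scalar_prod_sum_lessThan[of _ m])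
      (auto simp: index_finsum_vec_real intro!: sum.cong)
  also have "\<dots> = (\<Sum>i\<in>I. \<Sum>j<m. g $ j * (u i $ j - v i $ j))"
    by (subst sum.swap) (simp add: sum_distrib_left sum_subtractf right_diff_distrib)
  also have "\<dots> = (\<Sum>i\<in>I. g \<bullet> (u i - v i))"
    using assms by (intro sum.cong refl)
      (auto simp: scalar_prod_sum_lessThan[of _ m] index_minus_carrier_vec[of _ m])
  finally show ?thesis .
qed

text \<open>Cauchy-Schwarz in every coordinate. The factor \<open>card I\<close> becomes one of the
  two factors \<open>n\<close> in the square of the Lipschitz constant
  \<open>n * Ll\<close>.\<close>

lemma enorm_power2_finsum_diff_le:
  assumes "finite I"
    "\<And>i. i \<in> I \<Longrightarrow> u i \<in> carrier_vec m" "\<And>i. i \<in> I \<Longrightarrow> v i \<in> carrier_vec m"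
  shows "(enorm (finsum_vec TYPE(real) m u I - finsum_vec TYPE(real) m v I))\<^sup>2
    \<le> real (card I) * (\<Sum>i\<in>I. (enorm (u i - v i))\<^sup>2)"
proof -
  have c: "finsum_vec TYPE(real) m u I \<in> carrier_vec m" "finsum_vec TYPE(real) m v I \<in> carrier_vec m"
    using assms by (auto intro!: finsum_vec_carrier)
  have "(enorm (finsum_vec TYPE(real) m u I - finsum_vec TYPE(real) m v I))\<^sup>2
      = (\<Sum>j<m. (\<Sum>i\<in>I. u i $ j - v i $ j)\<^sup>2)"
    using assms c by (subst enorm_power2[of _ m])
      (auto simp: index_finsum_vec_real sum_subtractf intro!: sum.cong)
  also have "\<dots> \<le> (\<Sum>j<m. (\<Sum>i\<in>I. (u i $ j - v i $ j)\<^sup>2) * real (card I))"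
    by (intro sum_mono sum_squared_le_sum_of_squares)
  also have "\<dots> = real (card I) * (\<Sum>i\<in>I. \<Sum>j<m. (u i $ j - v i $ j)\<^sup>2)"
    by (subst sum.swap) (simp add: mult.commute flip: sum_distrib_left)
  also have "(\<Sum>i\<in>I. \<Sum>j<m. (u i $ j - v i $ j)\<^sup>2) = (\<Sum>i\<in>I. (enorm (u i - v i))\<^sup>2)"
    using assms by (intro sum.cong refl)
      (auto simp: enorm_power2[of _ m] index_minus_carrier_vec[of _ m])
  finally show ?thesis .
qed

lemma block_dist_power2:
  assumes "\<And>i. i \<in> {1..n} \<Longrightarrow> u i \<in> carrier_vec (m i)" "\<And>i. i \<in> {1..n} \<Longrightarrow> v i \<in> carrier_vec (m i)"
  shows "(block_dist n m u v)\<^sup>2 = (\<Sum>i=1..n. (enorm (u i - v i))\<^sup>2)"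
proof -
  have "(block_dist n m u v)\<^sup>2 = (\<Sum>i=1..n. \<Sum>j<m i. (u i $ j - v i $ j)\<^sup>2)"
    by (simp add: block_dist_def L2_set_def sum_nonneg sum.Sigma case_prod_beta)
  also have "\<dots> = (\<Sum>i=1..n. (enorm (u i - v i))\<^sup>2)"
  proof (intro sum.cong refl)
    fix i assume "i \<in> {1..n}"
    then have "u i - v i \<in> carrier_vec (m i)" "v i \<in> carrier_vec (m i)" using assms by auto
    then show "(\<Sum>j<m i. (u i $ j - v i $ j)\<^sup>2) = (enorm (u i - v i))\<^sup>2"
      by (simp add: enorm_power2 index_minus_carrier_vec)
  qed
  finally show ?thesis .
qed

text \<open>A polynomial identity in each coordinate. Here \<open>g\<close> and \<open>h\<close>
  stand for one block of the operator at the current point and at the half step, so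
  \<open>w - \<gamma> \<cdot>\<^sub>v g\<close> is the half-step iterate.\<close>

lemma extragradient_step:
  assumes "w \<in> carrier_vec m" "u \<in> carrier_vec m" "g \<in> carrier_vec m" "h \<in> carrier_vec m"
  shows "(enorm (w - \<gamma> \<cdot>\<^sub>v h - u))\<^sup>2 = (enorm (w - u))\<^sup>2 - 2 * \<gamma> * (h \<bullet> (w - \<gamma> \<cdot>\<^sub>v g - u))
    + \<gamma>\<^sup>2 * (enorm (h - g))\<^sup>2 - (enorm (w - \<gamma> \<cdot>\<^sub>v g - w))\<^sup>2"
proof -
  have "w - \<gamma> \<cdot>\<^sub>v h - u \<in> carrier_vec m" "w - u \<in> carrier_vec m" "w - \<gamma> \<cdot>\<^sub>v g - u \<in> carrier_vec m"
    "h - g \<in> carrier_vec m" "w - \<gamma> \<cdot>\<^sub>v g - w \<in> carrier_vec m"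
    using assms by auto
  note sums = this[THEN enorm_power2] scalar_prod_sum_lessThan[OF this(3)]
  show ?thesis
    unfolding sums sum_distrib_left sum.distrib[symmetric] sum_subtractf[symmetric]
    using assms by (intro sum.cong refl) (simp add: power2_eq_square algebra_simps)
qed

section \<open>Gradients of smooth and of convex functions\<close>

lemma has_gradient_gradient:
  assumes "u \<in> carrier_vec m" "has_gradient m f g u"
  shows "has_gradient m f (gradient m f u) u"
  unfolding gradient_def using assms has_gradient_unique by (metis (no_types, lifting) theI)

lemma L_smooth_has_gradient:
  assumes "L_smooth m L f" "u \<in> carrier_vec m"
  shows "has_gradient m f (gradient m f u) u"
  using assms has_gradient_gradient unfolding L_smooth_def by blast

lemma L_smooth_gradient_carrier:
  assumes "L_smooth m L f" "u \<in> carrier_vec m"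
  shows "gradient m f u \<in> carrier_vec m"
  using L_smooth_has_gradient[OF assms] by (simp add: has_gradient_def)

text \<open>Move from \<open>u\<close> towards \<open>v\<close> by a small fraction
  \<open>t\<close>. Convexity bounds the increment of \<open>f\<close> from above, differentiability
  bounds it from below up to \<open>\<epsilon>\<close>; dividing by \<open>t\<close> and letting
  \<open>\<epsilon>\<close> tend to 0 gives the claim.\<close>

lemma convex_gradient_ineq:
  assumes f: "convex_fun m f" and g: "has_gradient m f g u"
    and u: "u \<in> carrier_vec m" and v: "v \<in> carrier_vec m"
  shows "f u + g \<bullet> (v - u) \<le> f v"
proof -
  have gc: "g \<in> carrier_vec m" using g by (simp add: has_gradient_def)
  have "g \<bullet> (v - u) \<le> f v - f u + \<epsilon> * enorm (v - u)" if "\<epsilon> > 0" for \<epsilon>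
  proof -
    obtain \<delta> where \<delta>: "\<delta> > 0" "\<And>w. w \<in> carrier_vec m \<Longrightarrow> enorm (w - u) < \<delta> \<Longrightarrow>
        \<bar>f w - f u - g \<bullet> (w - u)\<bar> \<le> \<epsilon> * enorm (w - u)"
      using g \<open>\<epsilon> > 0\<close> unfolding has_gradient_def by meson
    \<comment> \<open>The added 1 keeps the quotient meaningful when \<open>enorm (v - u)\<close> is
      0 and makes the distance \<open>t * enorm (v - u)\<close> strictly smaller than
      \<open>\<delta>\<close>.\<close>
    define t where "t = min 1 (\<delta> / (enorm (v - u) + 1))"
    have pos: "enorm (v - u) + 1 > 0" by (simp add: add_nonneg_pos)
    have t: "0 < t" "t \<le> 1" using \<delta>(1) pos by (auto simp: t_def)
    have "t * enorm (v - u) < t * (enorm (v - u) + 1)" using t by simp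
    also have "\<dots> \<le> \<delta> / (enorm (v - u) + 1) * (enorm (v - u) + 1)"
      using pos by (intro mult_right_mono) (auto simp: t_def)
    also have "\<dots> = \<delta>" using pos by simp
    finally have small: "t * enorm (v - u) < \<delta>" .
    define w where "w = (1 - t) \<cdot>\<^sub>v u + t \<cdot>\<^sub>v v"
    have w: "w \<in> carrier_vec m" using u v by (simp add: w_def)
    have wu: "w - u = t \<cdot>\<^sub>v (v - u)"
      using u v by (auto simp: w_def algebra_simps)
    have n: "enorm (w - u) = t * enorm (v - u)" using t by (simp add: wu enorm_smult)
    have s: "g \<bullet> (w - u) = t * (g \<bullet> (v - u))" unfolding wu using gc u v by simp
    have "f w \<le> (1 - t) * f u + t * f v"
      unfolding w_def using f u v t unfolding convex_fun_def by auto
    moreover have "t * (g \<bullet> (v - u)) - \<epsilon> * (t * enorm (v - u)) \<le> f w - f u"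
      using \<delta>(2)[OF w] small unfolding n s by linarith
    ultimately have "t * (g \<bullet> (v - u)) \<le> t * (f v - f u + \<epsilon> * enorm (v - u))"
      by (simp add: algebra_simps)
    then show ?thesis using t by simp
  qed
  note bound = this
  show ?thesis
  proof (cases "enorm (v - u) = 0")
    case True
    then show ?thesis using bound[of 1] by simp
  next
    case False
    then have pos: "enorm (v - u) > 0" using enorm_nonneg[of "v - u"] by linarith
    have "g \<bullet> (v - u) \<le> f v - f u + e" if "e > 0" for e
      using bound[of "e / enorm (v - u)"] that pos by simp
    then show ?thesis using field_le_epsilon[of "g \<bullet> (v - u)" "f v - f u"] by simp
  qed
qed

text \<open>Jensen's inequality through the tangent at the mean \<open>a\<close>: the linear terms
  sum to 0. The mean is described by its coordinates so that the result applies to block averages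
  and to the block sum of averages alike.\<close>

lemma convex_average_le:
  assumes f: "convex_fun m f" and smooth: "L_smooth m L f"
    and K: "K \<ge> 1" and w: "\<And>k. k < K \<Longrightarrow> w k \<in> carrier_vec m"
    and a: "a \<in> carrier_vec m" "\<And>j. j < m \<Longrightarrow> a $ j = (1 / real K) * (\<Sum>k<K. w k $ j)"
  shows "real K * f a \<le> (\<Sum>k<K. f (w k))"
proof -
  define g where "g = gradient m f a"
  have "(\<Sum>k<K. g \<bullet> (w k - a)) = (\<Sum>k<K. \<Sum>j<m. g $ j * (w k $ j - a $ j))"
    using w a by (intro sum.cong refl) (subst scalar_prod_sum_lessThan[of _ m], auto)
  also have "\<dots> = (\<Sum>j<m. g $ j * ((\<Sum>k<K. w k $ j) - real K * a $ j))"
    by (subst sum.swap) (simp add: sum_subtractf flip: sum_distrib_left)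
  also have "\<dots> = 0" using a K by simp
  finally have "real K * f a = (\<Sum>k<K. f a + g \<bullet> (w k - a))" by (simp add: sum.distrib)
  also have "\<dots> \<le> (\<Sum>k<K. f (w k))"
    unfolding g_def using w a f L_smooth_has_gradient[OF smooth] by (intro sum_mono convex_gradient_ineq) auto
  finally show ?thesis .
qed

section \<open>Attained extrema\<close>

text \<open>\<open>max_on\<close> and \<open>min_on\<close> rest on \<open>GREATEST\<close> and
  \<open>LEAST\<close>, so their values are known only once the extrema are attained; compactness
  and continuity provide this.\<close>

lemma continuous_real_attains:
  assumes S: "compactin T S" "S \<noteq> {}" and f: "continuous_map T euclideanreal f"
  shows "\<exists>a\<in>S. \<forall>w\<in>S. f w \<le> f a" "\<exists>a\<in>S. \<forall>w\<in>S. f a \<le> f w"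
proof -
  have "compact (f ` S)" "f ` S \<noteq> {}"
    using image_compactin[OF S(1) f] S(2) by simp_all
  then show "\<exists>a\<in>S. \<forall>w\<in>S. f w \<le> f a" "\<exists>a\<in>S. \<forall>w\<in>S. f a \<le> f w"
    using compact_attains_sup[of "f ` S"] compact_attains_inf[of "f ` S"] by auto
qed

lemma max_on_eq:
  assumes "a \<in> S" "\<And>w. w \<in> S \<Longrightarrow> f w \<le> f a"
  shows "max_on S f = f a"
  unfolding max_on_def using assms by (intro Greatest_equality) auto

lemma min_on_eq:
  assumes "a \<in> S" "\<And>w. w \<in> S \<Longrightarrow> f a \<le> f w"
  shows "min_on S f = f a"
  unfolding min_on_def using assms by (intro Least_equality) auto

lemma max_on_attained:
  assumes "compactin T S" "S \<noteq> {}" "continuous_map T euclideanreal f"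
  obtains a where "a \<in> S" "max_on S f = f a"
  using continuous_real_attains(1)[OF assms] max_on_eq that by metis

lemma min_on_attained:
  assumes "compactin T S" "S \<noteq> {}" "continuous_map T euclideanreal f"
  obtains a where "a \<in> S" "min_on S f = f a"
  using continuous_real_attains(2)[OF assms] min_on_eq that by metis

lemma le_max_on:
  assumes "compactin T S" "continuous_map T euclideanreal f" "w \<in> S"
  shows "f w \<le> max_on S f"
  using continuous_real_attains(1)[of T S f] max_on_eq[of _ S f] assms by (metis empty_iff)

section \<open>Continuity in the block topology\<close>

abbreviation block_topology :: "nat \<Rightarrow> (nat \<Rightarrow> nat) \<Rightarrow> (nat \<Rightarrow> real Matrix.vec) topology" where
  "block_topology n m \<equiv> Metric_space.mtopology (block_space n m) (block_dist n m)"

lemma topspace_block [simp]: "topspace (block_topology n m) = block_space n m"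
  by (simp add: Metric_space.topspace_mtopology[OF Metric_space_block])

text \<open>A single entry is dominated by the Euclidean norm of all entries, so every coordinate is
  1-Lipschitz for \<open>block_dist\<close>.\<close>

lemma continuous_map_block_coord:
  assumes "i \<in> {1..n}" "j < m i"
  shows "continuous_map (block_topology n m) euclideanreal (\<lambda>u. u i $ j)"
proof -
  have "u i $ j - v i $ j \<le> block_dist n m u v" for u v
    using member_le_L2_set[of "SIGMA i:{1..n}. {..<m i}" "(i, j)" "\<lambda>(i, j). u i $ j - v i $ j"] assms
    by (simp add: block_dist_def)
  then have le: "\<bar>v i $ j - u i $ j\<bar> \<le> block_dist n m u v" for u v
    using Metric_space.commute[OF Metric_space_block, of n m u v] by (smt (verit))
  show ?thesis
    unfolding Metric_space.continuous_map_from_metric[OF Metric_space_block]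
  proof (intro conjI ballI allI impI)
    fix u :: "nat \<Rightarrow> real Matrix.vec" and U :: "real set"
    assume "openin euclideanreal U \<and> u i $ j \<in> U"
    then obtain e where "e > 0" "ball (u i $ j) e \<subseteq> U"
      using openE[of U "u i $ j"] by auto
    then have "e > 0" "\<And>t. \<bar>t - u i $ j\<bar> < e \<Longrightarrow> t \<in> U"
      by (auto simp: dist_real_def abs_minus_commute subset_iff)
    then show "\<exists>r>0. \<forall>v. v \<in> block_space n m \<and> block_dist n m u v < r \<longrightarrow> v i $ j \<in> U"
      using le by (meson le_less_trans)
  qed auto
qed

text \<open>Differentiability at \<open>h a\<close> with error factor 1 bounds the increment of
  \<open>f\<close> near \<open>h a\<close> by \<open>enorm g + 1\<close> times the distance.
  Composing with \<open>h\<close> reduces all topology to real-valued coordinates.\<close>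

lemma continuous_map_differentiable_compose:
  assumes f: "\<And>u. u \<in> carrier_vec m \<Longrightarrow> \<exists>g. has_gradient m f g u"
    and h: "\<And>w. w \<in> topspace T \<Longrightarrow> h w \<in> carrier_vec m"
    and cont: "\<And>j. j < m \<Longrightarrow> continuous_map T euclideanreal (\<lambda>w. h w $ j)"
  shows "continuous_map T euclideanreal (\<lambda>w. f (h w))"
  unfolding continuous_map_atin limitin_canonical_iff
proof
  fix a assume a: "a \<in> topspace T"
  define N where "N w = enorm (h w - h a)" for w
  obtain g where g: "has_gradient m f g (h a)" using f h a by blast
  then have gc: "g \<in> carrier_vec m" by (simp add: has_gradient_def)
  obtain \<delta> where \<delta>: "\<delta> > 0" "\<And>v. v \<in> carrier_vec m \<Longrightarrow> enorm (v - h a) < \<delta> \<Longrightarrow>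
      \<bar>f v - f (h a) - g \<bullet> (v - h a)\<bar> \<le> 1 * enorm (v - h a)"
    using g[unfolded has_gradient_def, THEN conjunct2, rule_format, of 1] by auto
  have top: "\<forall>\<^sub>F w in atin T a. w \<in> topspace T"
    unfolding eventually_atin using a by auto
  have "((\<lambda>w. sqrt (\<Sum>j<m. (h w $ j - h a $ j)\<^sup>2)) \<longlongrightarrow> sqrt (\<Sum>j<m. (h a $ j - h a $ j)\<^sup>2)) (atin T a)"
    using cont a unfolding continuous_map_atin limitin_canonical_iff
    by (intro tendsto_intros) auto
  moreover have "N w = sqrt (\<Sum>j<m. (h w $ j - h a $ j)\<^sup>2)" if "w \<in> topspace T" for w
    using h[OF a] by (simp add: N_def enorm_def L2_set_def)
  ultimately have N: "(N \<longlongrightarrow> 0) (atin T a)"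
    using top by (auto elim!: tendsto_cong[THEN iffD1, rotated] eventually_mono)
  then have lim: "((\<lambda>w. (enorm g + 1) * N w) \<longlongrightarrow> 0) (atin T a)"
    by (rule tendsto_mult_right_zero)
  have "\<forall>\<^sub>F w in atin T a. norm (f (h w) - f (h a)) \<le> (enorm g + 1) * N w"
    using top order_tendstoD(2)[OF N \<open>\<delta> > 0\<close>]
  proof eventually_elim
    case (elim w)
    then have hw: "h w \<in> carrier_vec m" by (simp add: h)
    have "\<bar>g \<bullet> (h w - h a)\<bar> \<le> enorm g * N w"
      unfolding N_def using gc hw h[OF a] by (intro abs_scalar_prod_le) auto
    moreover have "\<bar>f (h w) - f (h a) - g \<bullet> (h w - h a)\<bar> \<le> N w"
      using \<delta>(2)[OF hw] elim by (simp add: N_def)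
    ultimately show ?case by (simp add: algebra_simps)
  qed
  then have "((\<lambda>w. f (h w) - f (h a)) \<longlongrightarrow> 0) (atin T a)"
    using lim by (rule Lim_null_comparison)
  then show "((\<lambda>w. f (h w)) \<longlongrightarrow> f (h a)) (atin T a)" by (simp add: LIM_zero_iff)
qed

lemma block_spaceD:
  assumes "u \<in> block_space n m" "i \<in> {1..n}"
  shows "u i \<in> carrier_vec (m i)"
  using assms by (auto simp: block_space_def)

lemma continuous_map_scalar_prod:
  fixes f g :: "'a \<Rightarrow> real Matrix.vec"
  assumes "\<And>w. w \<in> topspace T \<Longrightarrow> g w \<in> carrier_vec m"
    "\<And>j. j < m \<Longrightarrow> continuous_map T euclideanreal (\<lambda>w. f w $ j)"
    "\<And>j. j < m \<Longrightarrow> continuous_map T euclideanreal (\<lambda>w. g w $ j)"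
  shows "continuous_map T euclideanreal (\<lambda>w. f w \<bullet> g w)"
  by (rule continuous_map_eq[where f = "\<lambda>w. \<Sum>j<m. f w $ j * g w $ j"])
    (use assms in \<open>auto intro!: continuous_intros simp: scalar_prod_sum_lessThan[of _ m]\<close>)

text \<open>The arguments are continuous maps from an arbitrary space \<open>T\<close>, which covers
  both the maximum over \<open>y\<close> with \<open>x\<close> and \<open>z\<close> held constant
  and the minimum over the product of the \<open>x\<close> and \<open>z\<close> spaces with
  \<open>y\<close> held constant.\<close>

lemma continuous_map_lagrangian:
  assumes A: "\<And>i. i \<in> {1..n} \<Longrightarrow> A i \<in> carrier_mat s (d i)"
    and l: "L_smooth s Ll (\<lambda>u. l u b)" and r: "\<And>i. i \<in> {1..n} \<Longrightarrow> L_smooth (d i) Lr (r i)"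
    and X: "continuous_map T (block_topology n d) X"
    and Z: "continuous_map T (block_topology n (\<lambda>_. s)) Z"
    and Y: "continuous_map T (block_topology n (\<lambda>_. s)) Y"
  shows "continuous_map T euclideanreal (\<lambda>w. lagrangian n s A l b r (X w) (Z w) (Y w))"
proof -
  have sp: "X w i \<in> carrier_vec (d i)" "Z w i \<in> carrier_vec s" "Y w i \<in> carrier_vec s"
    if w: "w \<in> topspace T" and i: "i \<in> {1..n}" for w i
    using funcset_mem[OF continuous_map_funspace[OF X] w] funcset_mem[OF continuous_map_funspace[OF Z] w]
      funcset_mem[OF continuous_map_funspace[OF Y] w] block_spaceD[OF _ i] unfolding topspace_block by blast+
  note coord = continuous_map_compose[OF X continuous_map_block_coord, unfolded o_def]
    continuous_map_compose[OF Z continuous_map_block_coord, unfolded o_def]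
    continuous_map_compose[OF Y continuous_map_block_coord, unfolded o_def]
  have "continuous_map T euclideanreal (\<lambda>w. l (finsum_vec TYPE(real) s (Z w) {1..n}) b)"
  proof (rule continuous_map_differentiable_compose[where f = "\<lambda>u. l u b" and m = s])
    show "\<And>u. u \<in> carrier_vec s \<Longrightarrow> \<exists>g. has_gradient s (\<lambda>u. l u b) g u"
      using l by (auto simp: L_smooth_def)
    show "\<And>w. w \<in> topspace T \<Longrightarrow> finsum_vec TYPE(real) s (Z w) {1..n} \<in> carrier_vec s"
      by (intro finsum_vec_carrier) (auto simp: sp)
    show "continuous_map T euclideanreal (\<lambda>w. finsum_vec TYPE(real) s (Z w) {1..n} $ j)" if "j < s" for j
      by (rule continuous_map_eq[where f = "\<lambda>w. \<Sum>i\<in>{1..n}. Z w i $ j"])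
        (use that in \<open>auto intro!: continuous_map_sum coord index_finsum_vec_real[symmetric] simp: sp\<close>)
  qed
  moreover have "continuous_map T euclideanreal (\<lambda>w. r i (X w i))" if i: "i \<in> {1..n}" for i
    by (rule continuous_map_differentiable_compose[where m = "d i"])
      (use i r in \<open>auto intro!: coord simp: L_smooth_def sp\<close>)
  moreover have "continuous_map T euclideanreal (\<lambda>w. Y w i \<bullet> (A i *\<^sub>v X w i - Z w i))" if i: "i \<in> {1..n}" for i
  proof (rule continuous_map_scalar_prod[where m = s])
    show "\<And>w. w \<in> topspace T \<Longrightarrow> A i *\<^sub>v X w i - Z w i \<in> carrier_vec s"
      using A i sp(1,2) by (meson minus_carrier_vec mult_mat_vec_carrier)
    show "\<And>j. j < s \<Longrightarrow> continuous_map T euclideanreal (\<lambda>w. Y w i $ j)"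
      using i by (intro coord)
    fix j assume j: "j < s"
    have dim: "j < dim_row (A i)" using A[OF i] j by simp
    have "continuous_map T euclideanreal (\<lambda>w. row (A i) j \<bullet> X w i)"
      using i by (intro continuous_map_scalar_prod[where m = "d i"] coord) (auto simp: sp)
    then have "continuous_map T euclideanreal (\<lambda>w. row (A i) j \<bullet> X w i - Z w i $ j)"
      using i j by (intro continuous_intros coord)
    then show "continuous_map T euclideanreal (\<lambda>w. (A i *\<^sub>v X w i - Z w i) $ j)"
      by (rule continuous_map_eq)
        (use i j dim in \<open>auto simp: index_minus_carrier_vec[of _ s] sp\<close>)
  qed
  ultimately show ?thesis
    unfolding lagrangian_def by (intro continuous_intros) auto
qed

lemma continuous_map_block_dist_power2:
  assumes "continuous_map T (block_topology n m) U"
  shows "continuous_map T euclideanreal (\<lambda>w. (block_dist n m u (U w))\<^sup>2)"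
proof -
  note coord = continuous_map_compose[OF assms continuous_map_block_coord, unfolded o_def]
  show ?thesis
    unfolding block_dist_def L2_set_def
    by (auto simp: sum_nonneg case_prod_beta intro!: continuous_intros coord)
qed

section \<open>The largest eigenvalue of the Gram matrix\<close>

text \<open>The unit sphere is modelled as a closed subset \<open>S\<close> of the cube in a finite
  product of real lines, where it is compact; the continuous function \<open>F\<close> is the
  squared norm of the image under \<open>A\<close>.\<close>

lemma ex_enorm_mult_mat_vec_maximizer:
  assumes A: "A \<in> carrier_mat s m" and m: "m \<ge> 1"
  shows "\<exists>e\<in>carrier_vec m. enorm e = 1 \<and>
    (\<forall>u\<in>carrier_vec m. enorm u = 1 \<longrightarrow> (enorm (A *\<^sub>v u))\<^sup>2 \<le> (enorm (A *\<^sub>v e))\<^sup>2)"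
proof -
  define T where "T = product_topology (\<lambda>_. euclideanreal) {..<m}"
  define S where "S = {f \<in> topspace T. (\<Sum>j<m. (f j)\<^sup>2) \<in> {1::real}}"
  define F :: "(nat \<Rightarrow> real) \<Rightarrow> real" where "F f = (\<Sum>i<s. (\<Sum>j<m. A $$ (i, j) * f j)\<^sup>2)" for f
  have proj: "continuous_map T euclideanreal (\<lambda>f. f j)" if "j < m" for j
    using continuous_map_product_projection[of j "{..<m}" "\<lambda>_. euclideanreal"] that by (simp add: T_def)
  have F: "continuous_map T euclideanreal F"
    unfolding F_def by (intro continuous_intros proj) auto
  have "closedin T S"
    unfolding S_def by (rule closedin_continuous_map_preimage[where Y = euclideanreal])
      (auto intro!: continuous_intros proj)
  moreover have "S \<subseteq> (\<Pi>\<^sub>E j\<in>{..<m}. {-1..1})"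
  proof
    fix f assume f: "f \<in> S"
    have "\<bar>f j\<bar> \<le> 1" if "j < m" for j
    proof -
      have "(f j)\<^sup>2 \<le> (\<Sum>j<m. (f j)\<^sup>2)" using that by (intro member_le_sum) auto
      then show ?thesis using f by (simp add: S_def abs_square_le_1)
    qed
    moreover have "f \<in> extensional {..<m}" using f by (auto simp: S_def T_def PiE_iff)
    ultimately show "f \<in> (\<Pi>\<^sub>E j\<in>{..<m}. {-1..1})" by (auto simp: PiE_iff abs_le_iff)
  qed
  moreover have "compactin T (\<Pi>\<^sub>E j\<in>{..<m}. {-1..1})"
    unfolding T_def compactin_PiE by simp
  ultimately have S: "compactin T S" by (meson closed_compactin)
  have restr: "restrict (vec_index u) {..<m} \<in> S" "F (restrict (vec_index u) {..<m}) = (enorm (A *\<^sub>v u))\<^sup>2"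
    if "u \<in> carrier_vec m" "enorm u = 1" for u
  proof -
    show "restrict (vec_index u) {..<m} \<in> S"
      using enorm_power2[OF that(1)] that(2) by (simp add: S_def T_def)
    show "F (restrict (vec_index u) {..<m}) = (enorm (A *\<^sub>v u))\<^sup>2"
      using that A by (simp add: F_def enorm_power2[of _ s] scalar_prod_sum_lessThan[of _ m])
  qed
  \<comment> \<open>Here \<open>m \<ge> 1\<close> enters: the first unit vector shows that the
    sphere is nonempty.\<close>
  have "enorm (unit_vec m 0) = 1"
    using m scalar_prod_self[of "unit_vec m 0"] by (simp add: abs_square_eq_1)
  then have "S \<noteq> {}" using restr(1)[of "unit_vec m 0"] by auto
  moreover have "compact (F ` S)" using image_compactin[OF S F] by simp
  ultimately obtain f where f: "f \<in> S" "\<forall>g\<in>S. F g \<le> F f"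
    using compact_attains_sup[of "F ` S"] by auto
  define e where "e = Matrix.vec m f"
  have e: "e \<in> carrier_vec m" "(enorm e)\<^sup>2 = 1"
    using f(1) by (simp_all add: e_def enorm_power2[of _ m] S_def)
  then have e1: "enorm e = 1" by (simp add: power2_eq_1_iff) (metis enorm_nonneg neg_0_le_iff_le not_one_le_zero)
  have "restrict (vec_index e) {..<m} = f"
    using f(1) by (auto simp: e_def S_def T_def PiE_iff extensional_def restrict_def fun_eq_iff)
  then show ?thesis using e(1) e1 restr f(2) by metis
qed

text \<open>The first-order condition at the minimum \<open>t = 0\<close> of a quadratic, used for
  the variation of a maximizer of the Rayleigh quotient.\<close>

lemma nonneg_quadratic_linear_coeff_zero:
  fixes b c :: real
  assumes "\<And>t. 0 \<le> 2 * t * b + t\<^sup>2 * c"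
  shows "b = 0"
proof (rule ccontr)
  assume b: "b \<noteq> 0"
  \<comment> \<open>A positive upper bound of \<open>c\<close>, whatever the sign of
    \<open>c\<close>. The test value \<open>- b / p\<close> minimizes the quadratic in which
    \<open>p\<close> replaces \<open>c\<close>, with the minimum
    \<open>- (b\<^sup>2 / p)\<close>.\<close>
  define p where "p = \<bar>c\<bar> + 1"
  have p: "p > 0" "c \<le> p" by (auto simp: p_def)
  have "0 \<le> 2 * (- b / p) * b + (- b / p)\<^sup>2 * c" by (rule assms)
  also have "\<dots> \<le> 2 * (- b / p) * b + (- b / p)\<^sup>2 * p"
    using p by (intro add_left_mono mult_left_mono) auto
  also have "\<dots> = - (b\<^sup>2 / p)" using p by (simp add: power2_eq_square field_simps)
  finally show False using b p by (simp add: divide_le_0_iff)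
qed

text \<open>The Rayleigh quotient of the Gram matrix attains its maximum on the unit sphere, and the
  first-order condition there says that the maximum is an eigenvalue.\<close>

lemma enorm_mult_mat_vec_power2_le:
  assumes A: "A \<in> carrier_mat s m" and m: "m \<ge> 1" and x: "x \<in> carrier_vec m"
  shows "(enorm (A *\<^sub>v x))\<^sup>2 \<le> Max (spectrum (A\<^sup>T * A)) * (enorm x)\<^sup>2"
proof -
  obtain e where e: "e \<in> carrier_vec m" "enorm e = 1"
    and max: "\<And>u. u \<in> carrier_vec m \<Longrightarrow> enorm u = 1 \<Longrightarrow> (enorm (A *\<^sub>v u))\<^sup>2 \<le> (enorm (A *\<^sub>v e))\<^sup>2"
    using ex_enorm_mult_mat_vec_maximizer[OF A m] by blast
  define \<mu> where "\<mu> = (enorm (A *\<^sub>v e))\<^sup>2"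
  have bound: "(enorm (A *\<^sub>v u))\<^sup>2 \<le> \<mu> * (enorm u)\<^sup>2" if u: "u \<in> carrier_vec m" for u
  proof (cases "enorm u = 0")
    case True
    then have "\<forall>j<m. u $ j = 0" using u by (auto simp: enorm_def L2_set_eq_0_iff)
    then have "A *\<^sub>v u = 0\<^sub>v s"
      using A u by (auto simp: scalar_prod_sum_lessThan[of _ m] intro!: eq_vecI)
    then show ?thesis using True by simp
  next
    case False
    define c where "c = 1 / enorm u"
    have "enorm (c \<cdot>\<^sub>v u) = 1" using False by (simp add: c_def enorm_smult)
    then have "(enorm (A *\<^sub>v (c \<cdot>\<^sub>v u)))\<^sup>2 \<le> \<mu>" unfolding \<mu>_def using u by (intro max) auto
    also have "A *\<^sub>v (c \<cdot>\<^sub>v u) = c \<cdot>\<^sub>v (A *\<^sub>v u)" using A u by (simp add: mult_mat_vec)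
    finally have "c\<^sup>2 * (enorm (A *\<^sub>v u))\<^sup>2 \<le> \<mu>" by (simp add: enorm_smult power_mult_distrib)
    then show ?thesis using False by (simp add: c_def field_simps)
  qed
  define G where "G = A\<^sup>T * A"
  have G: "G \<in> carrier_mat m m" using A by (simp add: G_def)
  have Gu: "(G *\<^sub>v u) \<bullet> h = (A *\<^sub>v u) \<bullet> (A *\<^sub>v h)" if "u \<in> carrier_vec m" "h \<in> carrier_vec m" for u h
  proof -
    have "G *\<^sub>v u = A\<^sup>T *\<^sub>v (A *\<^sub>v u)"
      unfolding G_def by (rule assoc_mult_mat_vec[of _ m s _ m]) (use A that in auto)
    then show ?thesis using transpose_vec_mult_scalar[OF A that(2), of "A *\<^sub>v u"] A that by simp
  qed
  \<comment> \<open>Since \<open>e\<close> attains equality in \<open>bound\<close>, the constant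
    terms cancel when \<open>bound\<close> is expanded at \<open>e + t \<cdot>\<^sub>v h\<close>;
    what remains is a nonnegative quadratic in \<open>t\<close> whose linear coefficient is twice
    the expression claimed to vanish.\<close>
  have orth: "\<mu> * (e \<bullet> h) - (A *\<^sub>v e) \<bullet> (A *\<^sub>v h) = 0" if h: "h \<in> carrier_vec m" for h
  proof (rule nonneg_quadratic_linear_coeff_zero[where c = "\<mu> * (enorm h)\<^sup>2 - (enorm (A *\<^sub>v h))\<^sup>2"])
    fix t :: real
    have expand: "(enorm (u + t \<cdot>\<^sub>v v))\<^sup>2 = (enorm u)\<^sup>2 + 2 * t * (u \<bullet> v) + t\<^sup>2 * (enorm v)\<^sup>2"
      if "u \<in> carrier_vec k" "v \<in> carrier_vec k" for u v :: "real Matrix.vec" and k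
      unfolding enorm_power2[OF that(1)] enorm_power2[OF that(2)] scalar_prod_sum_lessThan[OF that(2)]
        sum_distrib_left sum.distrib[symmetric]
      by (subst enorm_power2[of _ k])
        (use that in \<open>auto intro!: sum.cong simp: power2_eq_square algebra_simps\<close>)
    have "A *\<^sub>v (e + t \<cdot>\<^sub>v h) = A *\<^sub>v e + t \<cdot>\<^sub>v (A *\<^sub>v h)"
      using A e(1) h by (simp add: mult_add_distrib_mat_vec[of _ s m] mult_mat_vec)
    then show "0 \<le> 2 * t * (\<mu> * (e \<bullet> h) - (A *\<^sub>v e) \<bullet> (A *\<^sub>v h))
        + t\<^sup>2 * (\<mu> * (enorm h)\<^sup>2 - (enorm (A *\<^sub>v h))\<^sup>2)"
      using bound[of "e + t \<cdot>\<^sub>v h"] e h A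
      by (simp add: expand[of _ m] expand[of _ s] algebra_simps flip: \<mu>_def)
  qed
  \<comment> \<open>The residual of the eigenvalue equation. By \<open>orth\<close> it is orthogonal
    to itself, hence zero.\<close>
  define q where "q = \<mu> \<cdot>\<^sub>v e - G *\<^sub>v e"
  have q: "q \<in> carrier_vec m" "G *\<^sub>v e \<in> carrier_vec m" using G e by (auto simp: q_def)
  have "q \<bullet> q = (\<mu> \<cdot>\<^sub>v e) \<bullet> q - (G *\<^sub>v e) \<bullet> q"
    by (subst (1) q_def) (rule minus_scalar_prod_distrib[of _ m], use q e in auto)
  also have "\<dots> = 0" using orth[OF q(1)] Gu[OF e(1) q(1)] e q by simp
  finally have "\<forall>j<m. q $ j = 0"
    using q(1) by (simp add: scalar_prod_self enorm_def L2_set_eq_0_iff)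
  then have "G *\<^sub>v e = \<mu> \<cdot>\<^sub>v e" using q e G by (auto simp: q_def intro!: eq_vecI)
  moreover have "e \<noteq> 0\<^sub>v m" using e by auto
  ultimately have "\<mu> \<in> spectrum G"
    using e G by (auto simp: spectrum_def eigenvalue_def eigenvector_def)
  then have "\<mu> \<le> Max (spectrum G)" using card_finite_spectrum(1)[OF G] by simp
  then show ?thesis
    using bound[OF x] unfolding G_def by (meson mult_right_mono order_trans zero_le_power2)
qed

lemma enorm_mult_mat_vec_max_lambda:
  assumes "i \<in> {1..n}" "A i \<in> carrier_mat s m" "m \<ge> 1" "x \<in> carrier_vec m"
  shows "(enorm (A i *\<^sub>v x))\<^sup>2 \<le> max_lambda n A * (enorm x)\<^sup>2"
proof -
  have "Max (spectrum ((A i)\<^sup>T * A i)) \<le> max_lambda n A"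
    unfolding max_lambda_def using assms(1) by (intro Max_ge) auto
  then show ?thesis
    using enorm_mult_mat_vec_power2_le[OF assms(2-4)] by (meson mult_right_mono order_trans zero_le_power2)
qed

text \<open>The preceding bound at a unit vector shows that \<open>max_lambda n A\<close> dominates
  a square.\<close>

lemma max_lambda_nonneg:
  assumes "i \<in> {1..n}" "A i \<in> carrier_mat s m" "m \<ge> 1"
  shows "0 \<le> max_lambda n A"
proof -
  have "(enorm (unit_vec m 0))\<^sup>2 = 1"
    using assms(3) scalar_prod_self[of "unit_vec m 0"] by simp
  then show ?thesis
    using enorm_mult_mat_vec_max_lambda[of i n A s m "unit_vec m 0", OF assms unit_vec_carrier]
      zero_le_power2[of "enorm (A i *\<^sub>v unit_vec m 0)"] by (metis mult.right_neutral order_trans)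
qed

text \<open>A matrix and its transpose have the same operator norm. With \<open>v\<close> the image
  of \<open>y\<close>, the square of \<open>enorm v\<close> equals
  \<open>y \<bullet> (A i *\<^sub>v v)\<close>; Cauchy-Schwarz and the bound for \<open>A i\<close>
  then leave a common factor to cancel, so the spectrum of the other Gram matrix never
  appears.\<close>

lemma enorm_transpose_mult_mat_vec_max_lambda:
  assumes i: "i \<in> {1..n}" and A: "A i \<in> carrier_mat s m" and m: "m \<ge> 1" and y: "y \<in> carrier_vec s"
  shows "(enorm ((A i)\<^sup>T *\<^sub>v y))\<^sup>2 \<le> max_lambda n A * (enorm y)\<^sup>2"
proof -
  define v where "v = (A i)\<^sup>T *\<^sub>v y"
  define \<Lambda> where "\<Lambda> = max_lambda n A"
  have \<Lambda>: "0 \<le> \<Lambda>" unfolding \<Lambda>_def by (rule max_lambda_nonneg[of i n A s m, OF i A m])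
  have v: "v \<in> carrier_vec m" using A y by (simp add: v_def)
  have "v \<bullet> v = y \<bullet> (A i *\<^sub>v v)"
    unfolding v_def by (rule transpose_vec_mult_scalar) (use A y in auto)
  then have "(enorm v)\<^sup>2 \<le> enorm y * enorm (A i *\<^sub>v v)"
    using abs_scalar_prod_le[of y s "A i *\<^sub>v v"] A y v by (auto simp: scalar_prod_self)
  then have "((enorm v)\<^sup>2)\<^sup>2 \<le> (enorm y * enorm (A i *\<^sub>v v))\<^sup>2"
    by (intro power_mono) auto
  also have "\<dots> = (enorm y)\<^sup>2 * (enorm (A i *\<^sub>v v))\<^sup>2" by (simp add: power_mult_distrib)
  also have "\<dots> \<le> (enorm y)\<^sup>2 * (\<Lambda> * (enorm v)\<^sup>2)"
    unfolding \<Lambda>_def using enorm_mult_mat_vec_max_lambda[of i n A s m v] i A m v by (intro mult_left_mono) auto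
  finally have "(enorm v)\<^sup>2 * (enorm v)\<^sup>2 \<le> (\<Lambda> * (enorm y)\<^sup>2) * (enorm v)\<^sup>2"
    by (simp add: power2_eq_square algebra_simps)
  \<comment> \<open>The common factor cancels unless \<open>v\<close> has norm 0, and then
    \<open>0 \<le> \<Lambda>\<close> suffices.\<close>
  then have "(enorm v)\<^sup>2 \<le> \<Lambda> * (enorm y)\<^sup>2"
    using \<Lambda> by (cases "enorm v = 0") (simp, metis mult_right_le_imp_le zero_less_power2)
  then show ?thesis by (simp add: v_def \<Lambda>_def)
qed

section \<open>The saddle point problem\<close>

lemma block_average_carrier:
  assumes "i \<in> {1..n}" "\<And>k. k < K \<Longrightarrow> w k i \<in> carrier_vec (m i)"
  shows "block_average n m K w i \<in> carrier_vec (m i)"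
  using assms by (auto simp: block_average_def intro!: finsum_vec_carrier)

lemma block_average_in_block_space:
  assumes "\<And>k i. k < K \<Longrightarrow> i \<in> {1..n} \<Longrightarrow> w k i \<in> carrier_vec (m i)"
  shows "block_average n m K w \<in> block_space n m"
proof -
  have "block_average n m K w \<in> extensional {1..n}" by (simp add: block_average_def)
  then show ?thesis using assms by (auto simp: block_space_def PiE_def intro!: block_average_carrier)
qed

lemma index_block_average:
  assumes "i \<in> {1..n}" "\<And>k. k < K \<Longrightarrow> w k i \<in> carrier_vec (m i)" "j < m i"
  shows "block_average n m K w i $ j = (1 / real K) * (\<Sum>k<K. w k i $ j)"
proof -
  have "finsum_vec TYPE(real) (m i) (\<lambda>k. w k i) {..<K} \<in> carrier_vec (m i)"
    using assms by (intro finsum_vec_carrier) auto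
  moreover have "finsum_vec TYPE(real) (m i) (\<lambda>k. w k i) {..<K} $ j = (\<Sum>k<K. w k i $ j)"
    using assms by (intro index_finsum_vec_real) auto
  ultimately show ?thesis
    using assms by (simp add: block_average_def)
qed

lemma scalar_prod_block_average:
  assumes i: "i \<in> {1..n}" and w: "\<And>k. k < K \<Longrightarrow> w k i \<in> carrier_vec (m i)" and K: "K \<ge> 1"
  shows "real K * (g \<bullet> block_average n m K w i) = (\<Sum>k<K. g \<bullet> w k i)"
proof -
  have c: "block_average n m K w i \<in> carrier_vec (m i)"
    using i w by (rule block_average_carrier)
  have idx: "block_average n m K w i $ j = (1 / real K) * (\<Sum>k<K. w k i $ j)" if "j < m i" for j
    using i w that by (rule index_block_average)
  have "real K * (g \<bullet> block_average n m K w i) = (\<Sum>j<m i. g $ j * (\<Sum>k<K. w k i $ j))"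
    unfolding scalar_prod_sum_lessThan[OF c] sum_distrib_left[of "real K"]
    using K by (intro sum.cong refl) (simp add: idx)
  also have "\<dots> = (\<Sum>k<K. \<Sum>j<m i. g $ j * w k i $ j)"
    by (subst sum.swap) (simp add: sum_distrib_left)
  also have "\<dots> = (\<Sum>k<K. g \<bullet> w k i)"
    using w by (intro sum.cong refl) (simp add: scalar_prod_sum_lessThan[of _ "m i"])
  finally show ?thesis .
qed

section \<open>The Lagrangian and its operator\<close>

locale smooth_convex_saddle =
  fixes n s :: nat and d :: "nat \<Rightarrow> nat" and A :: "nat \<Rightarrow> real Matrix.mat"
    and l :: "real Matrix.vec \<Rightarrow> real Matrix.vec \<Rightarrow> real" and b :: "real Matrix.vec"
    and r :: "nat \<Rightarrow> real Matrix.vec \<Rightarrow> real" and Ll Lr :: real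
  assumes n: "n \<ge> 1" and d: "\<And>i. i \<in> {1..n} \<Longrightarrow> d i \<ge> 1"
    and A: "\<And>i. i \<in> {1..n} \<Longrightarrow> A i \<in> carrier_mat s (d i)"
    and l_smooth: "L_smooth s Ll (\<lambda>u. l u b)" and l_convex: "convex_fun s (\<lambda>u. l u b)"
    and r_smooth: "\<And>i. i \<in> {1..n} \<Longrightarrow> L_smooth (d i) Lr (r i)"
    and r_convex: "\<And>i. i \<in> {1..n} \<Longrightarrow> convex_fun (d i) (r i)"
begin

abbreviation "block_sum w \<equiv> finsum_vec TYPE(real) s w {1..n}"
abbreviation "grad_l \<equiv> gradient s (\<lambda>u. l u b)"
abbreviation "grad_r i \<equiv> gradient (d i) (r i)"
abbreviation "is_x u \<equiv> \<forall>i\<in>{1..n}. u i \<in> carrier_vec (d i)"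
abbreviation "is_s u \<equiv> \<forall>i\<in>{1..n}. u i \<in> carrier_vec s"

text \<open>The blocks of the monotone operator \<open>(\<nabla>\<^sub>x L, \<nabla>\<^sub>z L, - \<nabla>\<^sub>y L)\<close>.\<close>

definition "op_x x y i = (A i)\<^sup>T *\<^sub>v y i + grad_r i (x i)"
definition "op_z z y i = grad_l (block_sum z) - y i"
definition "op_y x z i = z i - A i *\<^sub>v x i"

lemma Ll_pos: "0 < Ll" and Lr_pos: "0 < Lr"
  using l_smooth r_smooth[of 1] n by (auto simp: L_smooth_def)

lemma block_sum_carrier: "is_s w \<Longrightarrow> block_sum w \<in> carrier_vec s"
  by (intro finsum_vec_carrier) auto

lemma grad_l_carrier: "u \<in> carrier_vec s \<Longrightarrow> grad_l u \<in> carrier_vec s"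
  by (rule L_smooth_gradient_carrier[OF l_smooth])

lemma grad_r_carrier: "i \<in> {1..n} \<Longrightarrow> u \<in> carrier_vec (d i) \<Longrightarrow> grad_r i u \<in> carrier_vec (d i)"
  by (rule L_smooth_gradient_carrier[OF r_smooth])

lemma mult_A_carrier: "i \<in> {1..n} \<Longrightarrow> u \<in> carrier_vec (d i) \<Longrightarrow> A i *\<^sub>v u \<in> carrier_vec s"
  using A by (meson mult_mat_vec_carrier)

lemma mult_AT_carrier: "i \<in> {1..n} \<Longrightarrow> u \<in> carrier_vec s \<Longrightarrow> (A i)\<^sup>T *\<^sub>v u \<in> carrier_vec (d i)"
  using A by (meson mult_mat_vec_carrier transpose_carrier_mat)

lemma op_carrier:
  assumes "is_x x" "is_s z" "is_s y" "i \<in> {1..n}"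
  shows "op_x x y i \<in> carrier_vec (d i)" "op_z z y i \<in> carrier_vec s" "op_y x z i \<in> carrier_vec s"
  unfolding op_x_def op_z_def op_y_def using assms
  by (intro grad_r_carrier mult_AT_carrier add_carrier_vec minus_carrier_vec mult_A_carrier
        grad_l_carrier block_sum_carrier; blast)+

lemma scalar_prod_mult_A:
  assumes "i \<in> {1..n}" "u \<in> carrier_vec (d i)" "v \<in> carrier_vec s"
  shows "v \<bullet> (A i *\<^sub>v u) = ((A i)\<^sup>T *\<^sub>v v) \<bullet> u"
  using transpose_vec_mult_scalar[OF A] assms by auto

text \<open>The tangent inequalities for \<open>l\<close> and for each \<open>r i\<close> account
  for the smooth terms. The bilinear coupling is skew in the operator and contributes an exact
  identity, so convexity is the only source of inequality.\<close>

lemma lagrangian_diff_le: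
  assumes X: "is_x x" "is_x x'" and Z: "is_s z" "is_s z'" and Y: "is_s y" "is_s y'"
  shows "lagrangian n s A l b r x z y' - lagrangian n s A l b r x' z' y
    \<le> (\<Sum>i=1..n. op_x x y i \<bullet> (x i - x' i) + op_z z y i \<bullet> (z i - z' i) + op_y x z i \<bullet> (y i - y' i))"
proof -
  define g where "g = grad_l (block_sum z)"
  have gc: "g \<in> carrier_vec s" unfolding g_def by (intro grad_l_carrier block_sum_carrier Z)
  have "l (block_sum z) b + g \<bullet> (block_sum z' - block_sum z) \<le> l (block_sum z') b"
    unfolding g_def using Z by (intro convex_gradient_ineq[OF l_convex L_smooth_has_gradient[OF l_smooth]] block_sum_carrier)
  moreover have "g \<bullet> (block_sum z' - block_sum z) = (\<Sum>i=1..n. g \<bullet> (z' i - z i))"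
    using Z gc by (intro scalar_prod_finsum_diff) auto
  moreover have "(\<Sum>i=1..n. r i (x i) + grad_r i (x i) \<bullet> (x' i - x i)) \<le> (\<Sum>i=1..n. r i (x' i))"
    using X by (intro sum_mono convex_gradient_ineq[OF r_convex L_smooth_has_gradient[OF r_smooth]]) auto
  moreover have "op_x x y i \<bullet> (x i - x' i) + op_z z y i \<bullet> (z i - z' i) + op_y x z i \<bullet> (y i - y' i)
      = y' i \<bullet> (A i *\<^sub>v x i - z i) - y i \<bullet> (A i *\<^sub>v x' i - z' i)
        - g \<bullet> (z' i - z i) - grad_r i (x i) \<bullet> (x' i - x i)" if i: "i \<in> {1..n}" for i
  proof -
    have c: "x i \<in> carrier_vec (d i)" "x' i \<in> carrier_vec (d i)" "z i \<in> carrier_vec s" "z' i \<in> carrier_vec s"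
      "y i \<in> carrier_vec s" "y' i \<in> carrier_vec s"
      using X Z Y i by auto
    note c' = mult_A_carrier[OF i c(1)] mult_A_carrier[OF i c(2)] mult_AT_carrier[OF i c(5)] mult_AT_carrier[OF i c(6)]
      grad_r_carrier[OF i c(1)]
    have 1: "op_x x y i \<bullet> (x i - x' i) = y i \<bullet> (A i *\<^sub>v x i) - y i \<bullet> (A i *\<^sub>v x' i) - grad_r i (x i) \<bullet> (x' i - x i)"
      unfolding op_x_def using c c'
      by (simp add: add_scalar_prod_distrib[of _ "d i"] scalar_prod_minus_distrib[of _ "d i"] scalar_prod_mult_A[OF i])
    have 2: "op_z z y i \<bullet> (z i - z' i) = - (g \<bullet> (z' i - z i)) - y i \<bullet> z i + y i \<bullet> z' i"
      unfolding op_z_def g_def[symmetric] using c c' gc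
      by (simp add: minus_scalar_prod_distrib[of _ s] scalar_prod_minus_distrib[of _ s])
    have 3: "op_y x z i \<bullet> (y i - y' i) = y i \<bullet> z i - y' i \<bullet> z i - y i \<bullet> (A i *\<^sub>v x i) + y' i \<bullet> (A i *\<^sub>v x i)"
      unfolding op_y_def using c c'
      by (simp add: minus_scalar_prod_distrib[of _ s] scalar_prod_minus_distrib[of _ s] comm_scalar_prod[of _ s "y i"]
          comm_scalar_prod[of _ s "y' i"])
    show ?thesis
      unfolding 1 2 3 using c c' by (simp add: scalar_prod_minus_distrib[of _ s])
  qed
  then have "(\<Sum>i=1..n. op_x x y i \<bullet> (x i - x' i) + op_z z y i \<bullet> (z i - z' i) + op_y x z i \<bullet> (y i - y' i))
      = (\<Sum>i=1..n. y' i \<bullet> (A i *\<^sub>v x i - z i)) - (\<Sum>i=1..n. y i \<bullet> (A i *\<^sub>v x' i - z' i))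
        - (\<Sum>i=1..n. g \<bullet> (z' i - z i)) - (\<Sum>i=1..n. grad_r i (x i) \<bullet> (x' i - x i))"
    unfolding sum_subtractf[symmetric] by (intro sum.cong refl)
  ultimately show ?thesis
    unfolding lagrangian_def by (simp add: sum.distrib)
qed

text \<open>Although the stepsize can exceed the inverse of the generic Lipschitz bound
  \<open>max Lr (n Ll) + sqrt (1 + \<lambda>)\<close>, the scaled operator is nonexpansive, because each of its three
  blocks is a sum of only two terms, each of which is Lipschitz with constant \<open>1/2\<close>.\<close>

lemma op_nonexpansive:
  assumes X: "is_x x" "is_x x'" and Z: "is_s z" "is_s z'" and Y: "is_s y" "is_s y'"
    and \<gamma>: "\<gamma>\<^sup>2 \<le> 1 / 4" "\<gamma>\<^sup>2 * max_lambda n A \<le> 1 / 4" "\<gamma>\<^sup>2 * Lr\<^sup>2 \<le> 1 / 4" "\<gamma>\<^sup>2 * (real n * Ll)\<^sup>2 \<le> 1 / 4"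
  shows "\<gamma>\<^sup>2 * (\<Sum>i=1..n. (enorm (op_x x y i - op_x x' y' i))\<^sup>2 + (enorm (op_z z y i - op_z z' y' i))\<^sup>2
      + (enorm (op_y x z i - op_y x' z' i))\<^sup>2)
    \<le> (\<Sum>i=1..n. (enorm (x i - x' i))\<^sup>2 + (enorm (z i - z' i))\<^sup>2 + (enorm (y i - y' i))\<^sup>2)"
proof -
  \<comment> \<open>The factor 2 from the square of a two-term sum, times the bound 1/4 on the
    scaled squared constants, leaves weight 1/2 on each term.\<close>
  have scale: "\<gamma>\<^sup>2 * (2 * a + 2 * b) \<le> (u + v) / 2"
    if "a \<le> c * u" "b \<le> e * v" "\<gamma>\<^sup>2 * c \<le> 1 / 4" "\<gamma>\<^sup>2 * e \<le> 1 / 4" "0 \<le> u" "0 \<le> v" for a b c e u v :: real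
  proof -
    have "\<gamma>\<^sup>2 * a \<le> \<gamma>\<^sup>2 * (c * u)" "\<gamma>\<^sup>2 * b \<le> \<gamma>\<^sup>2 * (e * v)"
      using that by (auto intro!: mult_left_mono)
    moreover have "\<gamma>\<^sup>2 * c * u \<le> 1 / 4 * u" "\<gamma>\<^sup>2 * e * v \<le> 1 / 4 * v"
      using mult_right_mono[OF that(3,5)] mult_right_mono[OF that(4,6)] by simp_all
    ultimately show ?thesis by (simp add: algebra_simps)
  qed
  define DX where "DX i = (enorm (x i - x' i))\<^sup>2" for i
  define DZ where "DZ i = (enorm (z i - z' i))\<^sup>2" for i
  define DY where "DY i = (enorm (y i - y' i))\<^sup>2" for i
  define G where "G = grad_l (block_sum z) - grad_l (block_sum z')"
  have G: "G \<in> carrier_vec s" unfolding G_def using Z by (intro minus_carrier_vec grad_l_carrier block_sum_carrier)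
  have "(enorm G)\<^sup>2 \<le> (Ll * enorm (block_sum z - block_sum z'))\<^sup>2"
    unfolding G_def using l_smooth block_sum_carrier Z by (intro power_mono) (auto simp: L_smooth_def)
  also have "\<dots> \<le> Ll\<^sup>2 * (real n * (\<Sum>i=1..n. DZ i))"
    unfolding power_mult_distrib DZ_def using Z enorm_power2_finsum_diff_le[of "{1..n}" z s z']
    by (intro mult_left_mono) auto
  \<comment> \<open>The same vector \<open>G\<close> occurs in all \<open>n\<close> blocks of
    \<open>op_z\<close>, which gives a second factor \<open>n\<close> besides the one from
    Cauchy-Schwarz; together they form the square of \<open>n * Ll\<close>.\<close>
  finally have "real n * (enorm G)\<^sup>2 \<le> real n * (Ll\<^sup>2 * (real n * (\<Sum>i=1..n. DZ i)))"
    by (intro mult_left_mono) auto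
  then have nG: "real n * (enorm G)\<^sup>2 \<le> (real n * Ll)\<^sup>2 * (\<Sum>i=1..n. DZ i)"
    by (simp add: power2_eq_square algebra_simps)
  have "\<gamma>\<^sup>2 * (enorm (op_x x y i - op_x x' y' i))\<^sup>2 \<le> (DY i + DX i) / 2" if i: "i \<in> {1..n}" for i
  proof -
    have c: "x i \<in> carrier_vec (d i)" "x' i \<in> carrier_vec (d i)" "y i \<in> carrier_vec s" "y' i \<in> carrier_vec s"
      using X Y i by auto
    note c' = mult_AT_carrier[OF i c(3)] mult_AT_carrier[OF i c(4)] grad_r_carrier[OF i c(1)] grad_r_carrier[OF i c(2)]
    have "op_x x y i - op_x x' y' i = (A i)\<^sup>T *\<^sub>v (y i - y' i) + (grad_r i (x i) - grad_r i (x' i))"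
      unfolding op_x_def using mult_minus_distrib_mat_vec[of "(A i)\<^sup>T" "d i" s "y i" "y' i"] A[OF i] c c'
      by (auto intro!: eq_vecI simp: index_minus_carrier_vec[of _ "d i"])
    then have "(enorm (op_x x y i - op_x x' y' i))\<^sup>2
        \<le> 2 * (enorm ((A i)\<^sup>T *\<^sub>v (y i - y' i)))\<^sup>2 + 2 * (enorm (grad_r i (x i) - grad_r i (x' i)))\<^sup>2"
      using enorm_power2_add_le[of "(A i)\<^sup>T *\<^sub>v (y i - y' i)" "d i"] c c' mult_AT_carrier[OF i, of "y i - y' i"] by simp
    then have "\<gamma>\<^sup>2 * (enorm (op_x x y i - op_x x' y' i))\<^sup>2
        \<le> \<gamma>\<^sup>2 * (2 * (enorm ((A i)\<^sup>T *\<^sub>v (y i - y' i)))\<^sup>2 + 2 * (enorm (grad_r i (x i) - grad_r i (x' i)))\<^sup>2)"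
      by (intro mult_left_mono) auto
    also have "\<dots> \<le> (DY i + DX i) / 2"
    proof (rule scale[OF _ _ \<gamma>(2,3)])
      show "(enorm ((A i)\<^sup>T *\<^sub>v (y i - y' i)))\<^sup>2 \<le> max_lambda n A * DY i"
        unfolding DY_def using i A[OF i] d[OF i] c by (intro enorm_transpose_mult_mat_vec_max_lambda) auto
      show "(enorm (grad_r i (x i) - grad_r i (x' i)))\<^sup>2 \<le> Lr\<^sup>2 * DX i"
        unfolding DX_def power_mult_distrib[symmetric] using r_smooth[OF i] c
        by (intro power_mono) (auto simp: L_smooth_def)
    qed (auto simp: DY_def DX_def)
    finally show ?thesis .
  qed
  then have 1: "\<gamma>\<^sup>2 * (\<Sum>i=1..n. (enorm (op_x x y i - op_x x' y' i))\<^sup>2) \<le> (\<Sum>i=1..n. (DY i + DX i) / 2)"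
    unfolding sum_distrib_left by (intro sum_mono)
  have "(enorm (op_z z y i - op_z z' y' i))\<^sup>2 \<le> 2 * (enorm G)\<^sup>2 + 2 * DY i" if i: "i \<in> {1..n}" for i
  proof -
    have c: "y i \<in> carrier_vec s" "y' i \<in> carrier_vec s" "block_sum z \<in> carrier_vec s" "block_sum z' \<in> carrier_vec s"
      using Y i block_sum_carrier[OF Z(1)] block_sum_carrier[OF Z(2)] by auto
    have "op_z z y i - op_z z' y' i = G - (y i - y' i)"
      unfolding op_z_def G_def using c c(3,4)[THEN grad_l_carrier]
      by (intro eq_vecI) (auto simp: index_minus_carrier_vec[of _ s])
    then show ?thesis using enorm_power2_diff_le[OF G, of "y i - y' i"] c by (simp add: DY_def)
  qed
  then have "(\<Sum>i=1..n. (enorm (op_z z y i - op_z z' y' i))\<^sup>2) \<le> (\<Sum>i=1..n. 2 * (enorm G)\<^sup>2 + 2 * DY i)"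
    by (intro sum_mono)
  also have "\<dots> = 2 * (real n * (enorm G)\<^sup>2) + 2 * (\<Sum>i=1..n. DY i)"
    by (simp add: sum.distrib flip: sum_distrib_left)
  finally have "\<gamma>\<^sup>2 * (\<Sum>i=1..n. (enorm (op_z z y i - op_z z' y' i))\<^sup>2)
      \<le> \<gamma>\<^sup>2 * (2 * (real n * (enorm G)\<^sup>2) + 2 * (\<Sum>i=1..n. DY i))"
    by (intro mult_left_mono) auto
  \<comment> \<open>The dual variable enters \<open>op_z\<close> with coefficient 1, as
    \<open>z\<close> does in \<open>op_y\<close>; this is what the entry 1 in the minimum defining
    the stepsize controls.\<close>
  also have "\<dots> \<le> ((\<Sum>i=1..n. DZ i) + (\<Sum>i=1..n. DY i)) / 2"
    by (rule scale[OF nG, of _ 1]) (use \<gamma> in \<open>auto simp: DZ_def DY_def intro!: sum_nonneg\<close>)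
  finally have 2: "\<gamma>\<^sup>2 * (\<Sum>i=1..n. (enorm (op_z z y i - op_z z' y' i))\<^sup>2)
      \<le> ((\<Sum>i=1..n. DZ i) + (\<Sum>i=1..n. DY i)) / 2" .
  have "\<gamma>\<^sup>2 * (enorm (op_y x z i - op_y x' z' i))\<^sup>2 \<le> (DZ i + DX i) / 2" if i: "i \<in> {1..n}" for i
  proof -
    have c: "x i \<in> carrier_vec (d i)" "x' i \<in> carrier_vec (d i)" "z i \<in> carrier_vec s" "z' i \<in> carrier_vec s"
      using X Z i by auto
    note c' = mult_A_carrier[OF i c(1)] mult_A_carrier[OF i c(2)]
    have "op_y x z i - op_y x' z' i = (z i - z' i) - A i *\<^sub>v (x i - x' i)"
      unfolding op_y_def using mult_minus_distrib_mat_vec[of "A i" s "d i" "x i" "x' i"] A[OF i] c c'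
      by (auto intro!: eq_vecI simp: index_minus_carrier_vec[of _ s])
    then have "(enorm (op_y x z i - op_y x' z' i))\<^sup>2 \<le> 2 * DZ i + 2 * (enorm (A i *\<^sub>v (x i - x' i)))\<^sup>2"
      using enorm_power2_diff_le[of "z i - z' i" s] c mult_A_carrier[OF i, of "x i - x' i"] by (simp add: DZ_def)
    then have "\<gamma>\<^sup>2 * (enorm (op_y x z i - op_y x' z' i))\<^sup>2 \<le> \<gamma>\<^sup>2 * (2 * DZ i + 2 * (enorm (A i *\<^sub>v (x i - x' i)))\<^sup>2)"
      by (intro mult_left_mono) auto
    also have "\<dots> \<le> (DZ i + DX i) / 2"
    proof (rule scale[of _ 1, OF _ _ _ \<gamma>(2)])
      show "(enorm (A i *\<^sub>v (x i - x' i)))\<^sup>2 \<le> max_lambda n A * DX i"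
        unfolding DX_def using i A[OF i] d[OF i] c by (intro enorm_mult_mat_vec_max_lambda) auto
    qed (use \<gamma> in \<open>auto simp: DZ_def DX_def\<close>)
    finally show ?thesis .
  qed
  then have 3: "\<gamma>\<^sup>2 * (\<Sum>i=1..n. (enorm (op_y x z i - op_y x' z' i))\<^sup>2) \<le> (\<Sum>i=1..n. (DZ i + DX i) / 2)"
    unfolding sum_distrib_left by (intro sum_mono)
  \<comment> \<open>Each of \<open>DX\<close>, \<open>DZ\<close> and \<open>DY\<close> occurs in
    exactly two of the three bounds with weight 1/2, so the bounds add up to the right-hand
    side.\<close>
  show ?thesis
    using 1 2 3 unfolding DX_def[symmetric] DY_def[symmetric] DZ_def[symmetric]
    by (simp add: sum.distrib distrib_left flip: sum_divide_distrib)
qed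

text \<open>For fixed \<open>y\<close> the Lagrangian is convex in \<open>(x, z)\<close>: Jensen's
  inequality handles \<open>l\<close> and the \<open>r i\<close>, while the coupling is linear and
  averages exactly.\<close>

lemma lagrangian_average_le:
  assumes xh: "\<And>k. k < K \<Longrightarrow> is_x (xh k)" and zh: "\<And>k. k < K \<Longrightarrow> is_s (zh k)"
    and y: "is_s y" and K: "K \<ge> 1"
  shows "real K * lagrangian n s A l b r (block_average n d K xh) (block_average n (\<lambda>_. s) K zh) y
    \<le> (\<Sum>k<K. lagrangian n s A l b r (xh k) (zh k) y)"
proof -
  define xa where "xa = block_average n d K xh"
  define za where "za = block_average n (\<lambda>_. s) K zh"
  have xa: "xa i \<in> carrier_vec (d i)" if "i \<in> {1..n}" for i
    unfolding xa_def using that xh by (intro block_average_carrier) auto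
  have za: "za i \<in> carrier_vec s" if "i \<in> {1..n}" for i
    unfolding za_def using that zh by (intro block_average_carrier[where m = "\<lambda>_. s"]) auto
  have idx: "xa i $ j = (1 / real K) * (\<Sum>k<K. xh k i $ j)" if "i \<in> {1..n}" "j < d i" for i j
    unfolding xa_def using that xh by (intro index_block_average) auto
  have "real K * l (block_sum za) b \<le> (\<Sum>k<K. l (block_sum (zh k)) b)"
  proof (rule convex_average_le[OF l_convex l_smooth K])
    \<comment> \<open>Averaging commutes with summation over blocks, so \<open>l\<close> is
      evaluated at the mean of the block sums.\<close>
    fix j assume j: "j < s"
    have "block_sum za $ j = (\<Sum>i=1..n. za i $ j)"
      using j za by (intro index_finsum_vec_real) auto
    also have "\<dots> = (\<Sum>i=1..n. (1 / real K) * (\<Sum>k<K. zh k i $ j))"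
      unfolding za_def using j zh by (intro sum.cong refl index_block_average[where m = "\<lambda>_. s"]) auto
    also have "\<dots> = (1 / real K) * (\<Sum>k<K. \<Sum>i=1..n. zh k i $ j)"
      unfolding sum_distrib_left[symmetric] by (subst sum.swap) (rule refl)
    also have "\<dots> = (1 / real K) * (\<Sum>k<K. block_sum (zh k) $ j)"
      using j zh by (intro arg_cong2[of _ _ _ _ "(*)"] sum.cong refl index_finsum_vec_real[symmetric]) auto
    finally show "block_sum za $ j = (1 / real K) * (\<Sum>k<K. block_sum (zh k) $ j)" .
  qed (use zh za block_sum_carrier in blast)+
  moreover have "(\<Sum>i=1..n. real K * r i (xa i)) \<le> (\<Sum>i=1..n. \<Sum>k<K. r i (xh k i))"
  proof (rule sum_mono)
    fix i assume i: "i \<in> {1..n}"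
    show "real K * r i (xa i) \<le> (\<Sum>k<K. r i (xh k i))"
      by (rule convex_average_le[OF r_convex[OF i] r_smooth[OF i] K _ xa[OF i] idx[OF i]]) (use xh i in blast)
  qed
  moreover have "real K * (y i \<bullet> (A i *\<^sub>v xa i - za i)) = (\<Sum>k<K. y i \<bullet> (A i *\<^sub>v xh k i - zh k i))"
    if i: "i \<in> {1..n}" for i
  proof -
    have yi: "y i \<in> carrier_vec s" using y i by auto
    have split: "y i \<bullet> (A i *\<^sub>v u - v) = ((A i)\<^sup>T *\<^sub>v y i) \<bullet> u - y i \<bullet> v"
      if "u \<in> carrier_vec (d i)" "v \<in> carrier_vec s" for u v
      using that yi mult_A_carrier[OF i that(1)]
      by (simp add: scalar_prod_minus_distrib[of _ s] scalar_prod_mult_A[OF i])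
    have "(\<Sum>k<K. y i \<bullet> (A i *\<^sub>v xh k i - zh k i)) = (\<Sum>k<K. ((A i)\<^sup>T *\<^sub>v y i) \<bullet> xh k i) - (\<Sum>k<K. y i \<bullet> zh k i)"
      unfolding sum_subtractf[symmetric] using xh zh i by (intro sum.cong refl split) auto
    also have "\<dots> = real K * (((A i)\<^sup>T *\<^sub>v y i) \<bullet> xa i) - real K * (y i \<bullet> za i)"
      unfolding xa_def za_def using xh zh i K
      by (subst (1 2) scalar_prod_block_average) auto
    finally show ?thesis using split[OF xa za] i by (simp add: right_diff_distrib)
  qed
  then have "(\<Sum>i=1..n. real K * (y i \<bullet> (A i *\<^sub>v xa i - za i))) = (\<Sum>i=1..n. \<Sum>k<K. y i \<bullet> (A i *\<^sub>v xh k i - zh k i))"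
    by (intro sum.cong refl)
  ultimately show ?thesis
    unfolding lagrangian_def xa_def[symmetric] za_def[symmetric] sum.distrib
    unfolding sum.swap[of _ "{1..n}" "{..<K}"] distrib_left sum_distrib_left by linarith
qed

text \<open>The Lagrangian is affine in \<open>y\<close>, hence an equality.\<close>

lemma lagrangian_average_dual:
  assumes x: "is_x x" and z: "is_s z" and yh: "\<And>k. k < K \<Longrightarrow> is_s (yh k)" and K: "K \<ge> 1"
  shows "real K * lagrangian n s A l b r x z (block_average n (\<lambda>_. s) K yh)
    = (\<Sum>k<K. lagrangian n s A l b r x z (yh k))"
proof -
  define ya where "ya = block_average n (\<lambda>_. s) K yh"
  have "real K * (ya i \<bullet> (A i *\<^sub>v x i - z i)) = (\<Sum>k<K. yh k i \<bullet> (A i *\<^sub>v x i - z i))"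
    if i: "i \<in> {1..n}" for i
  proof -
    define c where "c = A i *\<^sub>v x i - z i"
    have c: "c \<in> carrier_vec s" using x z i mult_A_carrier by (auto simp: c_def)
    have ya: "ya i \<in> carrier_vec s"
      unfolding ya_def using yh i by (intro block_average_carrier[where m = "\<lambda>_. s"]) auto
    have "(\<Sum>k<K. yh k i \<bullet> c) = (\<Sum>k<K. c \<bullet> yh k i)"
      using yh i c by (intro sum.cong refl comm_scalar_prod[of _ s]) auto
    also have "\<dots> = real K * (c \<bullet> ya i)"
      unfolding ya_def using yh i K by (subst scalar_prod_block_average) auto
    finally show ?thesis unfolding c_def[symmetric] using comm_scalar_prod[OF c ya] by simp
  qed
  then have "(\<Sum>i=1..n. real K * (ya i \<bullet> (A i *\<^sub>v x i - z i))) = (\<Sum>i=1..n. \<Sum>k<K. yh k i \<bullet> (A i *\<^sub>v x i - z i))"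
    by (intro sum.cong refl)
  then show ?thesis
    unfolding lagrangian_def ya_def[symmetric] sum.distrib
    unfolding sum.swap[of _ "{1..n}" "{..<K}"] distrib_left by (simp add: sum_distrib_left)
qed

end

section \<open>The extragradient method\<close>

text \<open>Each entry of the minimum bounds \<open>\<gamma>\<close> from above. The last claim is a
  bound from below: some entry \<open>1 / c\<close> attains the minimum, and \<open>c\<close> is one
  summand of the nonnegative sum.\<close>

lemma stepsize_bounds:
  assumes \<gamma>: "ereal \<gamma> = stepsize n A Lr Ll"
    and n: "n \<ge> 1" and pos: "0 < Lr" "0 < Ll" and \<Lambda>: "0 \<le> max_lambda n A"
  shows "0 < \<gamma>" "\<gamma>\<^sup>2 \<le> 1 / 4" "\<gamma>\<^sup>2 * max_lambda n A \<le> 1 / 4"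
    "\<gamma>\<^sup>2 * Lr\<^sup>2 \<le> 1 / 4" "\<gamma>\<^sup>2 * (real n * Ll)\<^sup>2 \<le> 1 / 4"
    "1 \<le> 2 * \<gamma> * (1 + sqrt (max_lambda n A) + real n * Ll + Lr)"
proof -
  define \<sigma> where "\<sigma> = sqrt (max_lambda n A)"
  define S where "S = {1, 1 / ereal \<sigma>, 1 / ereal Lr, 1 / ereal (real n * Ll)}"
  have \<sigma>: "0 \<le> \<sigma>" "max_lambda n A = \<sigma>\<^sup>2" using \<Lambda> by (simp_all add: \<sigma>_def)
  have nLl: "0 < real n * Ll" using n pos by simp
  \<comment> \<open>An infinite minimum would contradict the equation with the real number
    \<open>\<gamma>\<close>.\<close>
  have "Min S = ereal (2 * \<gamma>)"
  proof (cases "Min S")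
    case (real t)
    then have "\<gamma> = 1 / 2 * t" using \<gamma> by (simp add: stepsize_def flip: \<sigma>_def S_def)
    then show ?thesis using real by simp
  qed (use \<gamma> in \<open>simp_all add: stepsize_def flip: \<sigma>_def S_def\<close>)
  moreover have "finite S" "S \<noteq> {}" by (simp_all add: S_def)
  then have "Min S \<in> S" "\<And>t. t \<in> S \<Longrightarrow> Min S \<le> t" by simp_all
  ultimately have mem: "ereal (2 * \<gamma>) \<in> S" and le: "\<And>t. t \<in> S \<Longrightarrow> ereal (2 * \<gamma>) \<le> t" by simp_all
  \<comment> \<open>If \<open>\<sigma>\<close> is 0, its entry is infinite and cannot equal the real
    \<open>2 * \<gamma>\<close>; this is why that alternative comes with
    \<open>\<sigma> \<noteq> 0\<close>.\<close>
  have cases: "2 * \<gamma> = 1 \<or> \<sigma> \<noteq> 0 \<and> 2 * \<gamma> = 1 / \<sigma> \<or> 2 * \<gamma> = 1 / Lr \<or> 2 * \<gamma> = 1 / (real n * Ll)"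
    using mem pos nLl n by (cases "\<sigma> = 0") (auto simp: S_def one_ereal_def one_divide_ereal_zero)
  then show \<gamma>0: "0 < \<gamma>" using pos nLl \<sigma>(1) by (smt (verit) zero_less_divide_1_iff)
  have square: "\<gamma>\<^sup>2 * c\<^sup>2 \<le> 1 / 4" if "0 \<le> c" "2 * \<gamma> * c \<le> 1" for c :: real
  proof -
    have "(2 * \<gamma> * c)\<^sup>2 \<le> 1\<^sup>2" using that \<gamma>0 by (intro power_mono) auto
    then show ?thesis by (simp add: power_mult_distrib)
  qed
  have "2 * \<gamma> \<le> 1" using le[of 1] by (simp add: S_def one_ereal_def)
  then show "\<gamma>\<^sup>2 \<le> 1 / 4" using square[of 1] by simp
  have inv: "2 * \<gamma> * c \<le> 1" if "0 < c" "1 / ereal c \<in> S" for c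
    using le[OF that(2)] that(1) by (simp add: one_ereal_def pos_le_divide_eq)
  show "\<gamma>\<^sup>2 * max_lambda n A \<le> 1 / 4"
  proof (cases "\<sigma> = 0")
    case False
    then show ?thesis
      unfolding \<sigma>(2) using \<sigma>(1) by (intro square inv) (auto simp: S_def)
  qed (simp add: \<sigma>(2))
  show "\<gamma>\<^sup>2 * Lr\<^sup>2 \<le> 1 / 4" using pos by (intro square inv) (auto simp: S_def)
  show "\<gamma>\<^sup>2 * (real n * Ll)\<^sup>2 \<le> 1 / 4" using nLl by (intro square inv) (auto simp: S_def)
  have inverse_eq: "2 * \<gamma> * c = 1" if "c \<noteq> 0" "2 * \<gamma> = 1 / c" for c
    using that by simp
  obtain c where c: "2 * \<gamma> * c = 1" "c \<le> 1 + \<sigma> + real n * Ll + Lr"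
  proof -
    have "2 * \<gamma> * 1 = 1 \<or> 2 * \<gamma> * \<sigma> = 1 \<or> 2 * \<gamma> * Lr = 1 \<or> 2 * \<gamma> * (real n * Ll) = 1"
      using cases
    proof (elim disjE conjE)
      assume "2 * \<gamma> = 1"
      then show ?thesis by simp
    next
      assume "\<sigma> \<noteq> 0" "2 * \<gamma> = 1 / \<sigma>"
      then show ?thesis using inverse_eq by blast
    next
      assume "2 * \<gamma> = 1 / Lr"
      then show ?thesis using inverse_eq[of Lr] pos(1) by linarith
    next
      assume "2 * \<gamma> = 1 / (real n * Ll)"
      then show ?thesis using inverse_eq[of "real n * Ll"] nLl by linarith
    qed
    moreover have "1 \<le> 1 + \<sigma> + real n * Ll + Lr" "\<sigma> \<le> 1 + \<sigma> + real n * Ll + Lr"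
      "Lr \<le> 1 + \<sigma> + real n * Ll + Lr" "real n * Ll \<le> 1 + \<sigma> + real n * Ll + Lr"
      using pos(1) nLl \<sigma>(1) by linarith+
    ultimately show ?thesis using that by blast
  qed
  have "2 * \<gamma> * c \<le> 2 * \<gamma> * (1 + \<sigma> + real n * Ll + Lr)"
    using c(2) \<gamma>0 by (intro mult_left_mono) auto
  then show "1 \<le> 2 * \<gamma> * (1 + sqrt (max_lambda n A) + real n * Ll + Lr)"
    using c(1) by (simp add: \<sigma>_def)
qed

section \<open>Iterates and decrease of the potential\<close>

locale extragradient = smooth_convex_saddle +
  fixes \<gamma> :: real and K :: nat and x z y xh zh yh :: "nat \<Rightarrow> nat \<Rightarrow> real Matrix.vec"
  assumes \<gamma>: "ereal \<gamma> = stepsize n A Lr Ll"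
    and x0: "is_x (x 0)" and z0: "is_s (z 0)" and y0: "is_s (y 0)"
    and run: "extragradient_run n s d A l b r \<gamma> K x z y xh zh yh"
begin

lemma max_lambda_pos: "0 \<le> max_lambda n A"
  using max_lambda_nonneg[of 1 n A s "d 1"] n A[of 1] d[of 1] by simp

lemmas \<gamma>_bounds = stepsize_bounds[OF \<gamma> n Lr_pos Ll_pos max_lambda_pos]

lemma half_step:
  assumes "k < K" "i \<in> {1..n}"
  shows "xh k i = x k i - \<gamma> \<cdot>\<^sub>v op_x (x k) (y k) i"
    "zh k i = z k i - \<gamma> \<cdot>\<^sub>v op_z (z k) (y k) i"
    "yh k i = y k i + \<gamma> \<cdot>\<^sub>v (A i *\<^sub>v x k i - z k i)"
  using run assms by (auto simp: extragradient_run_def op_x_def op_z_def)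

lemma full_step:
  assumes "k < K" "i \<in> {1..n}"
  shows "x (Suc k) i = x k i - \<gamma> \<cdot>\<^sub>v op_x (xh k) (yh k) i"
    "z (Suc k) i = z k i - \<gamma> \<cdot>\<^sub>v op_z (zh k) (yh k) i"
    "y (Suc k) i = y k i + \<gamma> \<cdot>\<^sub>v (A i *\<^sub>v xh k i - zh k i)"
  using run assms by (auto simp: extragradient_run_def op_x_def op_z_def)

text \<open>Turns the ascent step in \<open>y\<close> into a descent step along \<open>op_y\<close>,
  so that \<open>extragradient_step\<close> serves all three blocks.\<close>

lemma plus_step_eq:
  assumes "v \<in> carrier_vec s" "w \<in> carrier_vec s"
  shows "u + \<gamma> \<cdot>\<^sub>v (v - w) = u - \<gamma> \<cdot>\<^sub>v (w - v)"
  using assms by (auto simp: algebra_simps)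

lemma half_carrier:
  assumes k: "k < K" and c: "is_x (x k)" "is_s (z k)" "is_s (y k)"
  shows "is_x (xh k)" "is_s (zh k)" "is_s (yh k)"
proof -
  have "xh k i \<in> carrier_vec (d i) \<and> zh k i \<in> carrier_vec s \<and> yh k i \<in> carrier_vec s" if i: "i \<in> {1..n}" for i
    using half_step[OF k i] op_carrier[OF c i] mult_A_carrier[OF i, of "x k i"] c i by simp
  then show "is_x (xh k)" "is_s (zh k)" "is_s (yh k)" by auto
qed

text \<open>The recursion holds only for indices below \<open>K\<close>, so the iterates are
  controlled exactly up to index \<open>K\<close>.\<close>

lemma iterate_carrier:
  "k \<le> K \<Longrightarrow> is_x (x k) \<and> is_s (z k) \<and> is_s (y k)"
proof (induction k)
  case 0
  then show ?case using x0 z0 y0 by simp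
next
  case (Suc k)
  then have k: "k < K" and c: "is_x (x k)" "is_s (z k)" "is_s (y k)" by auto
  note h = half_carrier[OF k c]
  have "x (Suc k) i \<in> carrier_vec (d i) \<and> z (Suc k) i \<in> carrier_vec s \<and> y (Suc k) i \<in> carrier_vec s"
    if i: "i \<in> {1..n}" for i
    using full_step[OF k i] op_carrier[OF h i] mult_A_carrier[OF i, of "xh k i"] c h i by simp
  then show ?case by auto
qed

lemmas iterate_carriers = iterate_carrier[OF less_imp_le, THEN conjunct1]
  iterate_carrier[OF less_imp_le, THEN conjunct2, THEN conjunct1]
  iterate_carrier[OF less_imp_le, THEN conjunct2, THEN conjunct2]

lemma half_carriers:
  assumes "k < K"
  shows "is_x (xh k)" "is_s (zh k)" "is_s (yh k)"
  using half_carrier[OF assms] iterate_carriers[OF assms] by blast+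

text \<open>At \<open>k = 0\<close> this is the quantity maximized in \<open>D_squared\<close>,
  written blockwise.\<close>

definition "potential ux uz uy k =
  (\<Sum>i=1..n. (enorm (x k i - ux i))\<^sup>2 + (enorm (z k i - uz i))\<^sup>2 + (enorm (y k i - uy i))\<^sup>2)"

lemma potential_step:
  assumes k: "k < K" and u: "is_x ux" "is_s uz" "is_s uy"
  shows "potential ux uz uy (Suc k) \<le> potential ux uz uy k
    - 2 * \<gamma> * (lagrangian n s A l b r (xh k) (zh k) uy - lagrangian n s A l b r ux uz (yh k))"
proof -
  note c = iterate_carriers[OF k] and h = half_carriers[OF k]
  define P where "P i = op_x (xh k) (yh k) i \<bullet> (xh k i - ux i) + op_z (zh k) (yh k) i \<bullet> (zh k i - uz i)
    + op_y (xh k) (zh k) i \<bullet> (yh k i - uy i)" for i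
  define Q where "Q i = (enorm (op_x (xh k) (yh k) i - op_x (x k) (y k) i))\<^sup>2
    + (enorm (op_z (zh k) (yh k) i - op_z (z k) (y k) i))\<^sup>2
    + (enorm (op_y (xh k) (zh k) i - op_y (x k) (z k) i))\<^sup>2" for i
  define R where "R i = (enorm (xh k i - x k i))\<^sup>2 + (enorm (zh k i - z k i))\<^sup>2 + (enorm (yh k i - y k i))\<^sup>2" for i
  have "(enorm (x (Suc k) i - ux i))\<^sup>2 + (enorm (z (Suc k) i - uz i))\<^sup>2 + (enorm (y (Suc k) i - uy i))\<^sup>2
      = (enorm (x k i - ux i))\<^sup>2 + (enorm (z k i - uz i))\<^sup>2 + (enorm (y k i - uy i))\<^sup>2
        - 2 * \<gamma> * P i + \<gamma>\<^sup>2 * Q i - R i" if i: "i \<in> {1..n}" for i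
  proof -
    note oc = op_carrier[OF c i] and oh = op_carrier[OF h i]
    have ci: "x k i \<in> carrier_vec (d i)" "z k i \<in> carrier_vec s" "y k i \<in> carrier_vec s"
      "xh k i \<in> carrier_vec (d i)" "zh k i \<in> carrier_vec s" "yh k i \<in> carrier_vec s"
      "ux i \<in> carrier_vec (d i)" "uz i \<in> carrier_vec s" "uy i \<in> carrier_vec s"
      using c h u i by auto
    have yh: "yh k i = y k i - \<gamma> \<cdot>\<^sub>v op_y (x k) (z k) i"
      unfolding half_step(3)[OF k i] op_y_def using ci by (intro plus_step_eq mult_A_carrier[OF i])
    have y: "y (Suc k) i = y k i - \<gamma> \<cdot>\<^sub>v op_y (xh k) (zh k) i"
      unfolding full_step(3)[OF k i] op_y_def using ci by (intro plus_step_eq mult_A_carrier[OF i])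
    show ?thesis
      using extragradient_step[OF ci(1,7) oc(1) oh(1), of \<gamma>] extragradient_step[OF ci(2,8) oc(2) oh(2), of \<gamma>]
        extragradient_step[OF ci(3,9) oc(3) oh(3), of \<gamma>]
      unfolding half_step(1,2)[OF k i, symmetric] yh[symmetric] full_step(1,2)[OF k i, symmetric] y[symmetric]
        P_def Q_def R_def
      by (simp add: distrib_left)
  qed
  then have "potential ux uz uy (Suc k) = (\<Sum>i=1..n. (enorm (x k i - ux i))\<^sup>2 + (enorm (z k i - uz i))\<^sup>2
      + (enorm (y k i - uy i))\<^sup>2 - 2 * \<gamma> * P i + \<gamma>\<^sup>2 * Q i - R i)"
    unfolding potential_def by (intro sum.cong refl)
  also have "\<dots> = potential ux uz uy k - 2 * \<gamma> * (\<Sum>i=1..n. P i) + (\<gamma>\<^sup>2 * (\<Sum>i=1..n. Q i) - (\<Sum>i=1..n. R i))"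
    by (simp add: potential_def sum_subtractf sum.distrib sum_distrib_left)
  \<comment> \<open>The bracket is nonpositive: \<open>op_nonexpansive\<close> compares the
    half-step point with the current one.\<close>
  also have "\<dots> \<le> potential ux uz uy k - 2 * \<gamma> * (\<Sum>i=1..n. P i)"
    using op_nonexpansive[OF h(1) c(1) h(2) c(2) h(3) c(3) \<gamma>_bounds(2-5)] by (simp add: Q_def R_def)
  also have "\<dots> \<le> potential ux uz uy k
      - 2 * \<gamma> * (lagrangian n s A l b r (xh k) (zh k) uy - lagrangian n s A l b r ux uz (yh k))"
    unfolding P_def using lagrangian_diff_le[OF h(1) u(1) h(2) u(2) h(3) u(3)] \<gamma>_bounds(1)
    by (intro diff_left_mono mult_left_mono) auto
  finally show ?thesis .
qed

text \<open>The step inequality telescopes and the final potential is dropped as nonnegative;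
  averaging then compares the mean of the Lagrangian differences with the difference at the
  averages.\<close>

lemma average_gap_le:
  assumes u: "is_x ux" "is_s uz" "is_s uy" and K: "K \<ge> 1"
  shows "lagrangian n s A l b r (block_average n d K xh) (block_average n (\<lambda>_. s) K zh) uy
      - lagrangian n s A l b r ux uz (block_average n (\<lambda>_. s) K yh)
    \<le> (1 + sqrt (max_lambda n A) + real n * Ll + Lr) * potential ux uz uy 0 / real K"
proof -
  define D where "D = lagrangian n s A l b r (block_average n d K xh) (block_average n (\<lambda>_. s) K zh) uy
      - lagrangian n s A l b r ux uz (block_average n (\<lambda>_. s) K yh)"
  define G where "G k = lagrangian n s A l b r (xh k) (zh k) uy - lagrangian n s A l b r ux uz (yh k)" for k
  have pot_nonneg: "0 \<le> potential ux uz uy k" for k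
    unfolding potential_def by (intro sum_nonneg) auto
  have "k \<le> K \<Longrightarrow> 2 * \<gamma> * (\<Sum>j<k. G j) \<le> potential ux uz uy 0 - potential ux uz uy k" for k
  proof (induction k)
    case (Suc k)
    then show ?case using potential_step[OF _ u, of k] by (simp add: G_def distrib_left)
  qed simp
  from this[of K] have tel: "2 * \<gamma> * (\<Sum>k<K. G k) \<le> potential ux uz uy 0"
    using pot_nonneg[of K] by simp
  have "real K * D \<le> (\<Sum>k<K. G k)"
    using lagrangian_average_le[where K = K and xh = xh and zh = zh and y = uy]
      lagrangian_average_dual[where K = K and x = ux and z = uz and yh = yh] half_carriers u K
    unfolding D_def G_def sum_subtractf right_diff_distrib by simp
  then have "2 * \<gamma> * (real K * D) \<le> 2 * \<gamma> * (\<Sum>k<K. G k)"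
    using \<gamma>_bounds(1) by (intro mult_left_mono) auto
  also note tel
  \<comment> \<open>The lower bound on the stepsize inserts a factor of at least 1, so that
    \<open>2 * \<gamma>\<close> appears on both sides and cancels.\<close>
  also have "potential ux uz uy 0
      \<le> 2 * \<gamma> * (1 + sqrt (max_lambda n A) + real n * Ll + Lr) * potential ux uz uy 0"
    using mult_right_mono[OF \<gamma>_bounds(6) pot_nonneg] by simp
  finally have "2 * \<gamma> * (real K * D)
      \<le> 2 * \<gamma> * ((1 + sqrt (max_lambda n A) + real n * Ll + Lr) * potential ux uz uy 0)"
    by (simp add: mult.assoc)
  then have "real K * D \<le> (1 + sqrt (max_lambda n A) + real n * Ll + Lr) * potential ux uz uy 0"
    using \<gamma>_bounds(1) by simp
  then show ?thesis
    unfolding D_def[symmetric] using K by (simp add: pos_le_divide_eq mult.commute)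
qed

text \<open>The extrema in the gap are attained, at \<open>uy\<close> and at
  \<open>(ux, uz)\<close>, so the gap is a difference of Lagrangians for one reference point. That
  point lies in the sets over which \<open>D_squared\<close> is the maximum.\<close>

lemma gap1_average_le:
  assumes X: "block_compact n d X" "X \<noteq> {}" and Z: "block_compact n (\<lambda>_. s) Z" "Z \<noteq> {}"
    and Y: "block_compact n (\<lambda>_. s) Y" "Y \<noteq> {}" and K: "K \<ge> 1"
  shows "gap1 n s A l b r X Z Y (block_average n d K xh) (block_average n (\<lambda>_. s) K zh) (block_average n (\<lambda>_. s) K yh)
    \<le> (1 + sqrt (max_lambda n A) + real n * Ll + Lr) * D_squared n s d X Z Y (x 0) (z 0) (y 0) / real K"
proof -
  let ?X = "block_topology n d" and ?S = "block_topology n (\<lambda>_. s)"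
  define xa where "xa = block_average n d K xh"
  define za where "za = block_average n (\<lambda>_. s) K zh"
  define ya where "ya = block_average n (\<lambda>_. s) K yh"
  \<comment> \<open>Constant maps into the block topology need their value in the space; the
    restriction to \<open>{1..n}\<close> in \<open>block_average\<close> provides the required
    extensionality.\<close>
  have avg: "xa \<in> topspace ?X" "za \<in> topspace ?S" "ya \<in> topspace ?S"
    unfolding topspace_block xa_def za_def ya_def
    by (rule block_average_in_block_space; use half_carriers in blast)+
  have comp: "compactin ?X X" "compactin ?S Z" "compactin ?S Y"
    using X(1) Z(1) Y(1) unfolding block_compact_def by blast+
  have sub: "X \<subseteq> block_space n d" "Z \<subseteq> block_space n (\<lambda>_. s)" "Y \<subseteq> block_space n (\<lambda>_. s)"
    using comp[THEN compactin_subset_topspace] unfolding topspace_block by blast+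
  have "continuous_map ?S euclideanreal (\<lambda>u. lagrangian n s A l b r xa za u)"
    using avg by (intro continuous_map_lagrangian[where d = d and Ll = Ll and Lr = Lr] A l_smooth r_smooth) simp_all
  with comp(3) Y(2) obtain uy where uy: "uy \<in> Y"
      "max_on Y (\<lambda>u. lagrangian n s A l b r xa za u) = lagrangian n s A l b r xa za uy"
    by (rule max_on_attained)
  have "continuous_map (prod_topology ?X ?S) euclideanreal (\<lambda>u. lagrangian n s A l b r (fst u) (snd u) ya)"
    using avg by (intro continuous_map_lagrangian[where d = d and Ll = Ll and Lr = Lr] A l_smooth r_smooth
        continuous_map_fst continuous_map_snd) simp_all
  then have "continuous_map (prod_topology ?X ?S) euclideanreal (\<lambda>(x', z'). lagrangian n s A l b r x' z' ya)"
    by (simp only: case_prod_unfold)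
  moreover have "compactin (prod_topology ?X ?S) (X \<times> Z)" "X \<times> Z \<noteq> {}"
    using comp X(2) Z(2) by (simp_all add: compactin_Times)
  ultimately obtain u where "u \<in> X \<times> Z" "min_on (X \<times> Z) (\<lambda>(x', z'). lagrangian n s A l b r x' z' ya)
      = (\<lambda>(x', z'). lagrangian n s A l b r x' z' ya) u"
    using min_on_attained[of "prod_topology ?X ?S" "X \<times> Z" "\<lambda>(x', z'). lagrangian n s A l b r x' z' ya"] by blast
  then obtain ux uz where uxz: "ux \<in> X" "uz \<in> Z"
      "min_on (X \<times> Z) (\<lambda>(x', z'). lagrangian n s A l b r x' z' ya) = lagrangian n s A l b r ux uz ya"
    by (elim SigmaE) simp
  have u: "is_x ux" "is_s uz" "is_s uy"
    using uxz(1,2) uy(1) sub by (auto dest!: subsetD block_spaceD)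
  let ?D = "\<lambda>(x', z', y'). (block_dist n d (x 0) x')\<^sup>2 + (block_dist n (\<lambda>_. s) (z 0) z')\<^sup>2
    + (block_dist n (\<lambda>_. s) (y 0) y')\<^sup>2"
  let ?T = "prod_topology ?X (prod_topology ?S ?S)"
  have cont: "continuous_map ?T euclideanreal ?D"
    unfolding case_prod_beta
    using continuous_map_block_dist_power2[OF continuous_map_fst]
      continuous_map_block_dist_power2[OF continuous_map_compose[OF continuous_map_snd continuous_map_fst, unfolded o_def]]
      continuous_map_block_dist_power2[OF continuous_map_compose[OF continuous_map_snd continuous_map_snd, unfolded o_def]]
    by (intro continuous_map_add)
  have "compactin ?T (X \<times> Z \<times> Y)"
    using comp by (simp add: compactin_Times)
  then have "?D (ux, uz, uy) \<le> D_squared n s d X Z Y (x 0) (z 0) (y 0)"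
    unfolding D_squared_def using uxz(1,2) uy(1) by (intro le_max_on[OF _ cont]) simp_all
  moreover have "?D (ux, uz, uy) = potential ux uz uy 0"
    unfolding potential_def sum.distrib prod.case
    by (intro arg_cong2[of _ _ _ _ "(+)"] block_dist_power2; use u x0 z0 y0 in blast)
  ultimately have le: "potential ux uz uy 0 \<le> D_squared n s d X Z Y (x 0) (z 0) (y 0)" by simp
  have "gap1 n s A l b r X Z Y xa za ya = lagrangian n s A l b r xa za uy - lagrangian n s A l b r ux uz ya"
    unfolding gap1_def uy(2) uxz(3) by simp
  also have "\<dots> \<le> (1 + sqrt (max_lambda n A) + real n * Ll + Lr) * potential ux uz uy 0 / real K"
    unfolding xa_def za_def ya_def by (rule average_gap_le[OF u K])
  also have "\<dots> \<le> (1 + sqrt (max_lambda n A) + real n * Ll + Lr) * D_squared n s d X Z Y (x 0) (z 0) (y 0) / real K"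
    using le max_lambda_pos Ll_pos Lr_pos by (intro divide_right_mono mult_left_mono add_nonneg_nonneg) auto
  finally show ?thesis unfolding xa_def za_def ya_def .
qed

end

theorem theorem8:
  shows "\<exists>C::real. C > 0 \<and>
    (\<forall>(n::nat) (s::nat) (d::nat \<Rightarrow> nat) (A::nat \<Rightarrow> real Matrix.mat)
      (l::real Matrix.vec \<Rightarrow> real Matrix.vec \<Rightarrow> real) (b::real Matrix.vec)
      (r::nat \<Rightarrow> real Matrix.vec \<Rightarrow> real) (Ll::real) (Lr::real)
      (X::(nat \<Rightarrow> real Matrix.vec) set) (Z::(nat \<Rightarrow> real Matrix.vec) set)
      (Y::(nat \<Rightarrow> real Matrix.vec) set) (\<gamma>::real)
      (x::nat \<Rightarrow> nat \<Rightarrow> real Matrix.vec) (z::nat \<Rightarrow> nat \<Rightarrow> real Matrix.vec)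
      (y::nat \<Rightarrow> nat \<Rightarrow> real Matrix.vec) (xh::nat \<Rightarrow> nat \<Rightarrow> real Matrix.vec)
      (zh::nat \<Rightarrow> nat \<Rightarrow> real Matrix.vec) (yh::nat \<Rightarrow> nat \<Rightarrow> real Matrix.vec) (K::nat).
      n \<ge> 1 \<longrightarrow> s \<ge> 1 \<longrightarrow> (\<forall>i\<in>{1..n}. d i \<ge> 1) \<longrightarrow>
      (\<forall>i\<in>{1..n}. A i \<in> carrier_mat s (d i)) \<longrightarrow> b \<in> carrier_vec s \<longrightarrow>
      block_compact n d X \<longrightarrow> X \<noteq> {} \<longrightarrow>
      block_compact n (\<lambda>_. s) Z \<longrightarrow> Z \<noteq> {} \<longrightarrow>
      block_compact n (\<lambda>_. s) Y \<longrightarrow> Y \<noteq> {} \<longrightarrow>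
      L_smooth s Ll (\<lambda>u. l u b) \<longrightarrow> convex_fun s (\<lambda>u. l u b) \<longrightarrow>
      (\<forall>i\<in>{1..n}. L_smooth (d i) Lr (r i) \<and> convex_fun (d i) (r i)) \<longrightarrow>
      ereal \<gamma> = stepsize n A Lr Ll \<longrightarrow>
      x 0 \<in> block_space n d \<longrightarrow> z 0 \<in> block_space n (\<lambda>_. s) \<longrightarrow> y 0 \<in> block_space n (\<lambda>_. s) \<longrightarrow>
      K \<ge> 1 \<longrightarrow> extragradient_run n s d A l b r \<gamma> K x z y xh zh yh \<longrightarrow>
      gap1 n s A l b r X Z Y (block_average n d K xh) (block_average n (\<lambda>_. s) K zh) (block_average n (\<lambda>_. s) K yh)
        \<le> C * ((1 + sqrt (max_lambda n A) + real n * Ll + Lr)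
               * D_squared n s d X Z Y (x 0) (z 0) (y 0) / real K))"
proof (intro exI[of _ "1::real"] conjI allI impI)
  fix n s :: nat and d A l b r Ll Lr X Z Y \<gamma> x z y xh zh yh K
  assume *: "n \<ge> 1" "\<forall>i\<in>{1..n}. d i \<ge> 1" "\<forall>i\<in>{1..n}. A i \<in> carrier_mat s (d i)"
    "L_smooth s Ll (\<lambda>u. l u b)" "convex_fun s (\<lambda>u. l u b)"
    "\<forall>i\<in>{1..n}. L_smooth (d i) Lr (r i) \<and> convex_fun (d i) (r i)"
    "ereal \<gamma> = stepsize n A Lr Ll"
    "x 0 \<in> block_space n d" "z 0 \<in> block_space n (\<lambda>_. s)" "y 0 \<in> block_space n (\<lambda>_. s)"
    "extragradient_run n s d A l b r \<gamma> K x z y xh zh yh"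
  assume XZY: "block_compact n d X" "X \<noteq> {}" "block_compact n (\<lambda>_. s) Z" "Z \<noteq> {}"
    "block_compact n (\<lambda>_. s) Y" "Y \<noteq> {}" and K: "K \<ge> 1"
  interpret extragradient n s d A l b r Ll Lr \<gamma> K x z y xh zh yh
    using * by unfold_locales (auto dest: block_spaceD)
  show "gap1 n s A l b r X Z Y (block_average n d K xh) (block_average n (\<lambda>_. s) K zh) (block_average n (\<lambda>_. s) K yh)
    \<le> 1 * ((1 + sqrt (max_lambda n A) + real n * Ll + Lr) * D_squared n s d X Z Y (x 0) (z 0) (y 0) / real K)"
    using gap1_average_le[OF XZY K] by simp
qed simp

end
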